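(* Let $n\ge1$, $N\in\mathbb{N}$, and let $f_1,\ldots,f_N\colon\mathbb{S}^n\to\mathbb{R}^+$ be bounded, integrable, and with proper support, with $\|f_i\|_\infty>0$ for all $i$. For nonnegative bounded integrable functions $g_1,\ldots,g_N$ on $\mathbb{S}^n$ set $$\tilde I(g_1,\ldots,g_N)=\int_{\mathbb{S}^n}\cdots\int_{\mathbb{S}^n}\lambda_n\big((\mathrm{conv}\{x_1,\ldots,x_N\})^*\big)\prod_{i=1}^N g_i(x_i)\,dx_1\cdots dx_N .$$ Then $$\tilde I(f_1,\ldots,f_N)\ \le\ \tilde I\big(\|f_1\|_\infty\mathbf{1}_{C_1},\ldots,\|f_N\|_\infty\mathbf{1}_{C_N}\big),$$ where $C_1,\ldots,C_N$ are spherical caps centered at a common point and satisfying $\lambda_n(C_i)=\|f_i\|_{L^1(\mathbb{S}^n)}/\|f_i\|_\infty$ for each $i$.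
   Context: $\mathbb{S}^n=\{x\in\mathbb{R}^{n+1}: x\cdot x=1\}$ with the Euclidean scalar product; $\lambda_n$ is the rotation-invariant $n$-dimensional Hausdorff measure on $\mathbb{S}^n$, and $dx$ means $d\lambda_n(x)$. A spherical cap is a geodesic ball for the distance $\arccos(x\cdot y)$. A set $K\subseteq\mathbb{S}^n$ is convex if for all $x,y\in K$ with $x\neq-y$ the shortest geodesic segment $[x,y]$ lies in $K$; $\mathrm{conv}\,K$ is the intersection of all convex sets containing $K$. A closed subset of $\mathbb{S}^n$ is proper if it is contained in an open hemisphere; a function $f$ on $\mathbb{S}^n$ has proper support if the closure of $\{f\neq0\}$ is proper. For $K\subseteq\mathbb{S}^n$ the polar set is $K^*=\{x\in\mathbb{S}^n: x\cdot y\le 0\text{ for all }y\in K\}$. $\mathbb{R}^+=[0,\infty)$, $\|\cdot\|_\infty$ is the $L^\infty$ norm, $\mathbf{1}_C$ the indicator function of $C$. *)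

theory Defs
  imports "HOL-Analysis.Analysis" "HOL-Probability.Essential_Supremum"
begin

section \<open>Hausdorff measure\<close>

text \<open>The constant \<open>unit_ball_vol n / 2 ^ n\<close> is the usual normalisation, for which the
  \<open>n\<close>-dimensional Hausdorff measure on \<open>n\<close>-dimensional Euclidean space is Lebesgue measure.\<close>

definition hausdorff_weight :: "nat \<Rightarrow> 'a::metric_space set \<Rightarrow> ennreal" where
  "hausdorff_weight n U =
    (if U = {} then 0 else ennreal (unit_ball_vol (real n) * (diameter U / 2) ^ n))"

text \<open>Boundedness has to be required explicitly: \<open>diameter\<close> is real-valued and unspecified on
  unbounded sets.\<close>

definition hausdorff_covers :: "real \<Rightarrow> 'a::metric_space set \<Rightarrow> (nat \<Rightarrow> 'a set) set" where
  "hausdorff_covers \<delta> A =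
    {U. A \<subseteq> (\<Union>i. U i) \<and> (\<forall>i. bounded (U i) \<and> diameter (U i) \<le> \<delta>)}"

definition hausdorff_pre :: "nat \<Rightarrow> real \<Rightarrow> 'a::metric_space set \<Rightarrow> ennreal" where
  "hausdorff_pre n \<delta> A = (INF U\<in>hausdorff_covers \<delta> A. \<Sum>i. hausdorff_weight n (U i))"

definition hausdorff_outer :: "nat \<Rightarrow> 'a::metric_space set \<Rightarrow> ennreal" where
  "hausdorff_outer n A = (SUP \<delta>\<in>{0<..}. hausdorff_pre n \<delta> A)"

text \<open>The measurable sets are the Caratheodory-measurable ones: all Borel sets (the outer
  measure being a metric one) and all sets of outer measure zero.\<close>

definition hausdorff_measure :: "nat \<Rightarrow> 'a::metric_space measure" where
  "hausdorff_measure n =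
    measure_of UNIV (lambda_system UNIV UNIV (hausdorff_outer n)) (hausdorff_outer n)"

lemma hausdorff_pre_countable_subadditive:
  "hausdorff_pre n \<delta> (\<Union>i. A i) \<le> (\<Sum>i. hausdorff_pre n \<delta> (A i))"
proof (rule ennreal_le_epsilon)
  fix e :: real
  assume fin: "(\<Sum>i. hausdorff_pre n \<delta> (A i)) < top" and e: "0 < e"
  have pos: "ennreal (e * (1/2) ^ Suc i) > 0" for i
    using e by simp
  have "\<exists>U\<in>hausdorff_covers \<delta> (A i).
      (\<Sum>j. hausdorff_weight n (U j)) \<le> hausdorff_pre n \<delta> (A i) + ennreal (e * (1/2) ^ Suc i)" for i
  proof -
    have "hausdorff_pre n \<delta> (A i) \<noteq> top"
      using fin ennreal_suminf_lessD less_top by metis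
    then have "hausdorff_pre n \<delta> (A i) < hausdorff_pre n \<delta> (A i) + ennreal (e * (1/2) ^ Suc i)"
      using pos[of i] ennreal_add_left_cancel_less[of "hausdorff_pre n \<delta> (A i)" 0]
      unfolding infinity_ennreal_def add_0_right by blast
    then show ?thesis
      unfolding hausdorff_pre_def[of n \<delta> "A i"] INF_less_iff by (auto intro: less_imp_le)
  qed
  then obtain U where U: "\<And>i. U i \<in> hausdorff_covers \<delta> (A i)"
    and Ub: "\<And>i. (\<Sum>j. hausdorff_weight n (U i j))
      \<le> hausdorff_pre n \<delta> (A i) + ennreal (e * (1/2) ^ Suc i)"
    by metis
  define V where "V k = case_prod U (prod_decode k)" for k
  have "V \<in> hausdorff_covers \<delta> (\<Union>i. A i)"
    unfolding hausdorff_covers_def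
  proof (intro CollectI conjI subsetI allI)
    fix x assume "x \<in> (\<Union>i. A i)"
    then obtain i j where "x \<in> U i j"
      using U unfolding hausdorff_covers_def by fast
    then have "x \<in> V (prod_encode (i, j))"
      by (simp add: V_def)
    then show "x \<in> (\<Union>k. V k)" by blast
  qed (use U in \<open>auto simp: V_def hausdorff_covers_def split: prod.splits\<close>)
  then have "hausdorff_pre n \<delta> (\<Union>i. A i) \<le> (\<Sum>k. hausdorff_weight n (V k))"
    unfolding hausdorff_pre_def by (rule INF_lower)
  also have "\<dots> = (\<Sum>k. (\<lambda>(i, j). hausdorff_weight n (U i j)) (prod_decode k))"
    by (simp add: V_def case_prod_unfold)
  also have "\<dots> = (\<Sum>i. \<Sum>j. hausdorff_weight n (U i j))"
    by (subst suminf_ennreal_2dimen[symmetric]) (auto simp: split_beta')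
  also have "\<dots> \<le> (\<Sum>i. hausdorff_pre n \<delta> (A i) + ennreal (e * (1/2) ^ Suc i))"
    by (intro suminf_le Ub) auto
  also have "\<dots> = (\<Sum>i. hausdorff_pre n \<delta> (A i)) + (\<Sum>i. ennreal (e * (1/2) ^ Suc i))"
    by (rule suminf_add[symmetric]) auto
  also have "(\<Sum>i. ennreal (e * (1/2) ^ Suc i)) = ennreal e"
    by (subst suminf_ennreal_eq[OF _ sums_mult[OF power_half_series]]) (use e in auto)
  finally show "hausdorff_pre n \<delta> (\<Union>i. A i) \<le> (\<Sum>i. hausdorff_pre n \<delta> (A i)) + ennreal e" .
qed

lemma outer_measure_space_hausdorff:
  "outer_measure_space UNIV (hausdorff_outer n :: 'a::metric_space set \<Rightarrow> ennreal)"
proof -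
  have "hausdorff_pre n \<delta> ({} :: 'a set) = 0" if "\<delta> > 0" for \<delta>
  proof -
    have "(\<lambda>_. {}) \<in> hausdorff_covers \<delta> ({} :: 'a set)"
      using that by (simp add: hausdorff_covers_def)
    then have "hausdorff_pre n \<delta> ({} :: 'a set) \<le> (\<Sum>i::nat. hausdorff_weight n ({} :: 'a set))"
      unfolding hausdorff_pre_def by (rule INF_lower2) simp
    then show ?thesis by (simp add: hausdorff_weight_def)
  qed
  then have 1: "hausdorff_outer n ({} :: 'a set) = 0"
    unfolding hausdorff_outer_def by (intro antisym SUP_least) auto
  have 2: "hausdorff_outer n A \<le> hausdorff_outer n B" if "A \<subseteq> B" for A B :: "'a set"
    unfolding hausdorff_outer_def hausdorff_pre_def
    using that by (intro SUP_mono' INF_superset_mono) (auto simp: hausdorff_covers_def)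
  have 3: "hausdorff_outer n (\<Union>i. A i) \<le> (\<Sum>i. hausdorff_outer n (A i))" for A :: "nat \<Rightarrow> 'a set"
  proof (subst hausdorff_outer_def, rule SUP_least)
    fix \<delta> :: real assume "\<delta> \<in> {0<..}"
    then have "hausdorff_pre n \<delta> (A i) \<le> hausdorff_outer n (A i)" for i
      unfolding hausdorff_outer_def by (rule SUP_upper)
    then have "(\<Sum>i. hausdorff_pre n \<delta> (A i)) \<le> (\<Sum>i. hausdorff_outer n (A i))"
      by (intro suminf_le) auto
    with hausdorff_pre_countable_subadditive
    show "hausdorff_pre n \<delta> (\<Union>i. A i) \<le> (\<Sum>i. hausdorff_outer n (A i))"
      by (rule order_trans)
  qed
  show ?thesis
    using 1 2 3
    by (auto simp: outer_measure_space_def positive_def increasing_def countably_subadditive_def)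
qed

lemma space_hausdorff_measure [simp]: "space (hausdorff_measure n) = UNIV"
  by (simp add: hausdorff_measure_def space_measure_of_conv)

lemma measure_space_hausdorff:
  "measure_space UNIV (lambda_system UNIV UNIV (hausdorff_outer n)) (hausdorff_outer n)"
  by (rule sigma_algebra.caratheodory_lemma[OF sigma_algebra_Pow, of UNIV, simplified])
    (rule outer_measure_space_hausdorff)

lemma sets_hausdorff_measure:
  "sets (hausdorff_measure n) = lambda_system UNIV UNIV (hausdorff_outer n)"
  unfolding hausdorff_measure_def
  by (rule sigma_algebra.sets_measure_of_eq)
    (simp add: measure_space_hausdorff[unfolded measure_space_def])

lemma emeasure_hausdorff_measure:
  assumes "A \<in> sets (hausdorff_measure n)"
  shows "emeasure (hausdorff_measure n) A = hausdorff_outer n A"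
proof -
  have "A \<in> lambda_system UNIV UNIV (hausdorff_outer n)"
    using assms by (simp only: sets_hausdorff_measure)
  then show ?thesis
    unfolding hausdorff_measure_def
    by (intro emeasure_measure_of_sigma)
      (simp_all add: measure_space_hausdorff[unfolded measure_space_def])
qed

section \<open>Spherical geometry\<close>

abbreviation usphere :: "'a::euclidean_space set" where
  "usphere \<equiv> sphere 0 1"

text \<open>\<open>sphere_measure n\<close> is \<open>\<lambda>\<^sub>n\<close> when the ambient space has dimension \<open>n + 1\<close>.\<close>

definition sphere_measure :: "nat \<Rightarrow> 'a::euclidean_space measure" where
  "sphere_measure n = restrict_space (hausdorff_measure n) usphere"

definition sdist :: "'a::euclidean_space \<Rightarrow> 'a \<Rightarrow> real" where
  "sdist x y = arccos (x \<bullet> y)"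

text \<open>Both closed and open geodesic balls are admitted.\<close>

definition is_cap :: "'a::euclidean_space \<Rightarrow> 'a set \<Rightarrow> bool" where
  "is_cap c C \<longleftrightarrow> c \<in> usphere \<and>
    (\<exists>r. C = {x \<in> usphere. sdist c x \<le> r} \<or> C = {x \<in> usphere. sdist c x < r})"

text \<open>The curve \<open>t \<mapsto> cos t *\<^sub>R x + sin t *\<^sub>R v\<close> is the unit-speed great circle issuing from \<open>x\<close>
  in the unit tangent direction \<open>v\<close>; it is a shortest path to \<open>y\<close> if it reaches \<open>y\<close> at time
  \<open>sdist x y\<close>.\<close>

definition geodesic_segment :: "'a::euclidean_space \<Rightarrow> 'a \<Rightarrow> 'a set" where
  "geodesic_segment x y = {cos t *\<^sub>R x + sin t *\<^sub>R v | t v.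
     norm v = 1 \<and> x \<bullet> v = 0 \<and> 0 \<le> t \<and> t \<le> sdist x y \<and>
     cos (sdist x y) *\<^sub>R x + sin (sdist x y) *\<^sub>R v = y}"

definition sconvex :: "'a::euclidean_space set \<Rightarrow> bool" where
  "sconvex K \<longleftrightarrow> K \<subseteq> usphere \<and>
    (\<forall>x\<in>K. \<forall>y\<in>K. x \<noteq> - y \<longrightarrow> geodesic_segment x y \<subseteq> K)"

definition sconv :: "'a::euclidean_space set \<Rightarrow> 'a set" where
  "sconv K = \<Inter>{L. sconvex L \<and> K \<subseteq> L}"

definition polar_set :: "'a::euclidean_space set \<Rightarrow> 'a set" where
  "polar_set K = {x \<in> usphere. \<forall>y\<in>K. x \<bullet> y \<le> 0}"

definition proper_set :: "'a::euclidean_space set \<Rightarrow> bool" where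
  "proper_set K \<longleftrightarrow> closed K \<and> K \<subseteq> usphere \<and>
    (\<exists>u\<in>usphere. K \<subseteq> {x \<in> usphere. u \<bullet> x > 0})"

definition has_proper_support :: "('a::euclidean_space \<Rightarrow> real) \<Rightarrow> bool" where
  "has_proper_support f \<longleftrightarrow> proper_set (closure {x \<in> usphere. f x \<noteq> 0})"

section \<open>Norms and the functional\<close>

definition L1_norm :: "'a measure \<Rightarrow> ('a \<Rightarrow> real) \<Rightarrow> real" where
  "L1_norm M f = (\<integral>x. \<bar>f x\<bar> \<partial>M)"

definition Linf_norm :: "'a measure \<Rightarrow> ('a \<Rightarrow> real) \<Rightarrow> real" where
  "Linf_norm M f = real_of_ereal (esssup M (\<lambda>x. ereal \<bar>f x\<bar>))"

text \<open>The iterated integral is written as an integral over the \<open>N\<close>-fold product measure.\<close>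

definition I_tilde :: "nat \<Rightarrow> nat \<Rightarrow> (nat \<Rightarrow> 'a::euclidean_space \<Rightarrow> real) \<Rightarrow> ennreal" where
  "I_tilde n N g =
    (\<integral>\<^sup>+ x. emeasure (sphere_measure n) (polar_set (sconv (x ` {1..N})))
             * (\<Prod>i\<in>{1..N}. ennreal (g i (x i)))
      \<partial>(\<Pi>\<^sub>M i\<in>{1..N}. sphere_measure n))"

end

theory Submission
  imports Defs
begin

text \<open>The polar of a spherical convex hull is the set of \<open>y\<close> with \<open>x\<^sub>i \<bullet> y \<le> 0\<close> for all \<open>i\<close>, because
closed hemispheres are convex.  Tonelli's theorem therefore turns the functional into
\<open>\<integral> (\<Prod>i. hemi f\<^sub>i y) dy\<close>, where \<open>hemi f y\<close> is the mass of \<open>f\<close> in the hemisphere opposite to \<open>y\<close>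
(\<open>nn_integral_polar\<close>).  After division by the essential suprema the \<open>f\<^sub>i\<close> may be taken to be Borel
functions with values in \<open>[0, 1]\<close>, to be compared with the indicators of the caps.

Let \<open>c\<close> be the common centre of the caps.  For a reflection \<open>\<sigma>\<close> that fixes a hyperplane through the
origin, put \<open>p + q - p * q\<close> in place of \<open>p = f x\<close> and \<open>p * q\<close> in place of \<open>q = f (\<sigma> x)\<close>, where \<open>x\<close> is
the one of the two points on the side of \<open>c\<close>.  This soft polarization is the average of the usual
two-point symmetrization over independent random sets with densities \<open>p\<close> and \<open>q\<close>; it keeps the
range \<open>[0, 1]\<close> and the total mass.  Applied to all \<open>f\<^sub>i\<close> with the same reflection, it does not decrease
the functional: at each pair \<open>y\<close>, \<open>\<sigma> y\<close> it keeps the sum of the two values of \<open>hemi f\<^sub>i\<close> and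
pushes the two values apart, the larger one ending up on the side opposite to \<open>c\<close> for every \<open>i\<close>
(\<open>polar_functional_soft_polarization\<close>).

Soft polarization moves mass into the caps: the amount gained by a cap \<open>C\<close> is at least one half of the
integral of \<open>(1 - f x) * f (\<sigma> x)\<close> over the \<open>x \<in> C\<close> with \<open>\<sigma> x \<notin> C\<close> (\<open>cap_mass_gain\<close>).  If
the normal of the mirror is chosen at random, then \<open>\<sigma> x\<close> charges every set with at least a fixed
fraction \<open>\<kappa>\<close> of its measure, so that the expected gain is at least \<open>\<kappa> / 2\<close> times the square of the
mass that the cap still misses.  Hence some reflection lowers the total deficit by a multiple of
its square (\<open>exists_improving_reflection\<close>), and deficits arbitrarily close to zero are reached
without decreasing the functional.  Since the functional is controlled by the \<open>L\<^sup>1\<close> distance to the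
caps, the inequality follows (\<open>polar_functional_le_caps\<close>).

Of the Hausdorff measure this uses that Borel sets are measurable, that measurable functions have
Borel versions, that the sphere has finite measure, and that an \<open>L\<close>-Lipschitz map enlarges
\<open>n\<close>-dimensional measure by at most \<open>L ^ n\<close>.  The last fact gives the invariance under reflections, and
also \<open>\<kappa> = 1 / 4 ^ n\<close>, as for fixed \<open>x\<close> the reflected point depends on the normal in a \<open>4\<close>-Lipschitz
way and reaches the whole sphere.\<close>

section \<open>Hausdorff outer measure\<close>

lemma hausdorff_outer_mono: "A \<subseteq> B \<Longrightarrow> hausdorff_outer n A \<le> hausdorff_outer n B"
  using outer_measure_space_hausdorff[of n] by (auto simp: outer_measure_space_def increasing_def)

lemma hausdorff_outer_empty [simp]: "hausdorff_outer n {} = 0"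
  using outer_measure_space_hausdorff[of n] by (auto simp: outer_measure_space_def positive_def)

lemma hausdorff_outer_UN: "hausdorff_outer n (\<Union>i::nat. A i) \<le> (\<Sum>i. hausdorff_outer n (A i))"
proof (subst hausdorff_outer_def, rule SUP_least)
  fix \<delta> :: real assume "\<delta> \<in> {0<..}"
  then have "(\<Sum>i. hausdorff_pre n \<delta> (A i)) \<le> (\<Sum>i. hausdorff_outer n (A i))"
    by (intro suminf_le) (auto simp: hausdorff_outer_def intro: SUP_upper)
  with hausdorff_pre_countable_subadditive
  show "hausdorff_pre n \<delta> (\<Union>i. A i) \<le> (\<Sum>i. hausdorff_outer n (A i))"
    by (rule order_trans)
qed

lemma hausdorff_outer_Un: "hausdorff_outer n (A \<union> B) \<le> hausdorff_outer n A + hausdorff_outer n B"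
proof -
  have "hausdorff_outer n (\<Union>i::nat. if i = 0 then A else if i = 1 then B else {})
      \<le> (\<Sum>i::nat. hausdorff_outer n (if i = 0 then A else if i = 1 then B else {}))"
    by (rule hausdorff_outer_UN)
  also have "(\<Sum>i::nat. hausdorff_outer n (if i = 0 then A else if i = 1 then B else {}))
      = (\<Sum>i\<in>{0,1::nat}. hausdorff_outer n (if i = 0 then A else if i = 1 then B else {}))"
    by (rule suminf_finite) auto
  also have "\<dots> = hausdorff_outer n A + hausdorff_outer n B"
    by simp
  also have "(\<Union>i::nat. if i = 0 then A else if i = 1 then B else {}) = A \<union> B"
  proof (intro equalityI subsetI)
    fix x assume "x \<in> A \<union> B"
    then have "x \<in> (if 0 = (0::nat) then A else if 0 = (1::nat) then B else {}) \<or>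
        x \<in> (if 1 = (0::nat) then A else if 1 = (1::nat) then B else {})"
      by simp
    then show "x \<in> (\<Union>i::nat. if i = 0 then A else if i = 1 then B else {})"
      by blast
  qed (auto split: if_splits)
  finally show ?thesis .
qed

lemma hausdorff_outer_finite_UN:
  "finite I \<Longrightarrow> hausdorff_outer n (\<Union>i\<in>I. A i) \<le> (\<Sum>i\<in>I. hausdorff_outer n (A i))"
proof (induction rule: finite_induct)
  case (insert i I)
  have "hausdorff_outer n (\<Union>i\<in>insert i I. A i) \<le> hausdorff_outer n (A i) + hausdorff_outer n (\<Union>i\<in>I. A i)"
    using hausdorff_outer_Un[of n "A i" "\<Union>i\<in>I. A i"] by simp
  with insert show ?case
    by (simp add: add_left_mono order_trans)
qed simp

lemma hausdorff_pre_le_outer: "0 < \<delta> \<Longrightarrow> hausdorff_pre n \<delta> A \<le> hausdorff_outer n A"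
  unfolding hausdorff_outer_def by (rule SUP_upper) simp

lemma hausdorff_pre_antimono: "\<delta> \<le> \<epsilon> \<Longrightarrow> hausdorff_pre n \<epsilon> A \<le> hausdorff_pre n \<delta> A"
  unfolding hausdorff_pre_def by (rule INF_superset_mono) (auto simp: hausdorff_covers_def intro: order_trans)

lemma hausdorff_weight_mono:
  assumes "A \<subseteq> B" "bounded B"
  shows "hausdorff_weight n A \<le> hausdorff_weight n B"
  using assms diameter_subset[OF assms] diameter_ge_0[OF bounded_subset[OF assms(2,1)]]
  by (auto simp: hausdorff_weight_def intro!: ennreal_leI mult_left_mono power_mono)

lemma hausdorff_weight_closure:
  "bounded A \<Longrightarrow> hausdorff_weight n (closure A) = hausdorff_weight n A"
  by (simp add: hausdorff_weight_def diameter_closure)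

lemma diameter_le_dist:
  assumes "0 \<le> d" "\<And>x y. x \<in> S \<Longrightarrow> y \<in> S \<Longrightarrow> dist x y \<le> d"
  shows "diameter S \<le> d"
  using assms by (auto simp: diameter_def intro!: cSUP_least)

text \<open>The image of a cover by sets of diameter at most \<open>\<delta> / L\<close> is a cover by sets of diameter at most \<open>\<delta>\<close>.\<close>
lemma hausdorff_outer_Lipschitz_image:
  fixes g :: "'a::metric_space \<Rightarrow> 'b::metric_space"
  assumes L: "L > 0" and lip: "\<And>x y. x \<in> A \<Longrightarrow> y \<in> A \<Longrightarrow> dist (g x) (g y) \<le> L * dist x y"
  shows "hausdorff_outer n (g ` A) \<le> ennreal (L ^ n) * hausdorff_outer n A"
  unfolding hausdorff_outer_def[of n "g ` A"]
proof (rule SUP_least)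
  fix \<delta> :: real assume "\<delta> \<in> {0<..}"
  then have \<delta>: "\<delta> > 0" by simp
  have "hausdorff_pre n \<delta> (g ` A) \<le> ennreal (L ^ n) * (\<Sum>i. hausdorff_weight n (U i))"
    if U: "U \<in> hausdorff_covers (\<delta> / L) A" for U
  proof -
    have bU: "bounded (U i \<inter> A)" "diameter (U i \<inter> A) \<le> diameter (U i)"
        "diameter (U i) \<le> \<delta> / L" "bounded (U i)" for i
      using U diameter_subset[of "U i \<inter> A" "U i"] bounded_subset[of "U i" "U i \<inter> A"]
      by (auto simp: hausdorff_covers_def)
    have diam: "diameter (g ` (U i \<inter> A)) \<le> L * diameter (U i)" (is ?D)
      and bdd: "bounded (g ` (U i \<inter> A))" (is ?B) for i
    proof -
      have *: "dist (g x) (g y) \<le> L * diameter (U i)" if "x \<in> U i \<inter> A" "y \<in> U i \<inter> A" for x y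
        using lip[of x y] that L diameter_bounded_bound[OF bU(4), of x i y]
        by (auto intro: order_trans mult_left_mono)
      show ?B
        unfolding bounded_two_points using * by blast
      show ?D
        using * L diameter_ge_0[OF bU(4), of i] by (intro diameter_le_dist) auto
    qed
    have "(\<lambda>i. g ` (U i \<inter> A)) \<in> hausdorff_covers \<delta> (g ` A)"
    proof -
      have "L * diameter (U i) \<le> \<delta>" for i
        using bU(3)[of i] L by (simp add: field_simps)
      then show ?thesis
        using U diam bdd by (fastforce simp: hausdorff_covers_def intro: order_trans)
    qed
    then have "hausdorff_pre n \<delta> (g ` A) \<le> (\<Sum>i. hausdorff_weight n (g ` (U i \<inter> A)))"
      unfolding hausdorff_pre_def by (rule INF_lower)
    also have "\<dots> \<le> (\<Sum>i. ennreal (L ^ n) * hausdorff_weight n (U i))"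
    proof (intro suminf_le allI)
      fix i
      show "hausdorff_weight n (g ` (U i \<inter> A)) \<le> ennreal (L ^ n) * hausdorff_weight n (U i)"
      proof (cases "U i \<inter> A = {}")
        case False
        have "unit_ball_vol (real n) * (diameter (g ` (U i \<inter> A)) / 2) ^ n
            \<le> unit_ball_vol (real n) * (L * diameter (U i) / 2) ^ n"
          using diam[of i] diameter_ge_0[OF bdd[of i]]
          by (intro mult_left_mono power_mono divide_right_mono) auto
        also have "\<dots> = L ^ n * (unit_ball_vol (real n) * (diameter (U i) / 2) ^ n)"
          by (simp add: power_mult_distrib power_divide)
        finally show ?thesis
          using False L by (auto simp: hausdorff_weight_def simp flip: ennreal_mult' intro!: ennreal_leI)
      qed (simp add: hausdorff_weight_def)
    qed auto
    also have "\<dots> = ennreal (L ^ n) * (\<Sum>i. hausdorff_weight n (U i))"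
      by (rule ennreal_suminf_cmult)
    finally show ?thesis .
  qed
  note le = this
  have inv: "ennreal (L ^ n) * ennreal (1 / L ^ n) = 1"
    using L by (simp flip: ennreal_mult)
  have "ennreal (1 / L ^ n) * hausdorff_pre n \<delta> (g ` A) \<le> hausdorff_pre n (\<delta> / L) A"
    unfolding hausdorff_pre_def[of n "\<delta> / L"]
  proof (rule INF_greatest)
    fix U assume "U \<in> hausdorff_covers (\<delta> / L) A"
    from mult_left_mono[OF le[OF this], of "ennreal (1 / L ^ n)"]
    show "ennreal (1 / L ^ n) * hausdorff_pre n \<delta> (g ` A) \<le> (\<Sum>i. hausdorff_weight n (U i))"
      using inv by (simp add: mult.assoc[symmetric] mult.commute[of "ennreal (1 / L ^ n)"])
  qed
  from mult_left_mono[OF this, of "ennreal (L ^ n)"]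
  have "hausdorff_pre n \<delta> (g ` A) \<le> ennreal (L ^ n) * hausdorff_pre n (\<delta> / L) A"
    using inv by (simp add: mult.assoc[symmetric])
  also have "\<dots> \<le> ennreal (L ^ n) * hausdorff_outer n A"
    using \<delta> L by (intro mult_left_mono hausdorff_pre_le_outer) auto
  finally show "hausdorff_pre n \<delta> (g ` A) \<le> ennreal (L ^ n) * hausdorff_outer n A" .
qed

text \<open>A set of diameter less than \<open>d\<close> cannot meet both \<open>A\<close> and \<open>B\<close>, so a fine cover of the union splits
into a cover of \<open>A\<close> and a cover of \<open>B\<close>.\<close>
lemma hausdorff_outer_separated:
  assumes d: "d > 0" and sep: "\<And>x y. x \<in> A \<Longrightarrow> y \<in> B \<Longrightarrow> d \<le> dist x y"
  shows "hausdorff_outer n A + hausdorff_outer n B \<le> hausdorff_outer n (A \<union> B)"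
proof -
  have pre: "hausdorff_pre n \<delta> A + hausdorff_pre n \<delta> B \<le> hausdorff_pre n \<delta> (A \<union> B)"
    if \<delta>: "0 < \<delta>" "\<delta> < d" for \<delta>
    unfolding hausdorff_pre_def[of n \<delta> "A \<union> B"]
  proof (rule INF_greatest)
    fix U assume U: "U \<in> hausdorff_covers \<delta> (A \<union> B)"
    then have bU: "bounded (U i)" "diameter (U i) \<le> \<delta>" for i
      by (auto simp: hausdorff_covers_def)
    have sub: "(\<lambda>i. U i \<inter> T) \<in> hausdorff_covers \<delta> T" if "T \<subseteq> A \<union> B" for T
      using U that bU diameter_subset[of "U _ \<inter> T" "U _"] bounded_subset[of "U _" "U _ \<inter> T"]
      by (fastforce simp: hausdorff_covers_def intro: order_trans)
    have "hausdorff_pre n \<delta> A + hausdorff_pre n \<delta> B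
        \<le> (\<Sum>i. hausdorff_weight n (U i \<inter> A)) + (\<Sum>i. hausdorff_weight n (U i \<inter> B))"
      unfolding hausdorff_pre_def using sub[of A] sub[of B]
      by (intro add_mono INF_lower) auto
    also have "\<dots> = (\<Sum>i. hausdorff_weight n (U i \<inter> A) + hausdorff_weight n (U i \<inter> B))"
      by (rule suminf_add) auto
    also have "\<dots> \<le> (\<Sum>i. hausdorff_weight n (U i))"
    proof (intro suminf_le allI)
      fix i
      have "U i \<inter> A = {} \<or> U i \<inter> B = {}"
      proof (rule ccontr)
        assume "\<not> ?thesis"
        then obtain x y where "x \<in> U i" "x \<in> A" "y \<in> U i" "y \<in> B" by blast
        then show False
          using sep[of x y] diameter_bounded_bound[OF bU(1), of x i y] bU(2)[of i] \<delta> by linarith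
      qed
      then show "hausdorff_weight n (U i \<inter> A) + hausdorff_weight n (U i \<inter> B) \<le> hausdorff_weight n (U i)"
      proof
        assume "U i \<inter> A = {}"
        then show ?thesis
          using hausdorff_weight_mono[of "U i \<inter> B" "U i" n] bU(1)
          by (simp add: hausdorff_weight_def[of n "{}"])
      next
        assume "U i \<inter> B = {}"
        then show ?thesis
          using hausdorff_weight_mono[of "U i \<inter> A" "U i" n] bU(1)
          by (simp add: hausdorff_weight_def[of n "{}"])
      qed
    qed auto
    finally show "hausdorff_pre n \<delta> A + hausdorff_pre n \<delta> B \<le> (\<Sum>i. hausdorff_weight n (U i))" .
  qed
  have *: "hausdorff_pre n \<delta> A + hausdorff_pre n \<epsilon> B \<le> hausdorff_outer n (A \<union> B)"
    if "0 < \<delta>" "0 < \<epsilon>" for \<delta> \<epsilon>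
  proof -
    define \<eta> where "\<eta> = min (min \<delta> \<epsilon>) (d / 2)"
    have \<eta>: "0 < \<eta>" "\<eta> < d" "\<eta> \<le> \<delta>" "\<eta> \<le> \<epsilon>"
      using that d by (auto simp: \<eta>_def min_def)
    have "hausdorff_pre n \<delta> A + hausdorff_pre n \<epsilon> B \<le> hausdorff_pre n \<eta> A + hausdorff_pre n \<eta> B"
      using \<eta> by (intro add_mono hausdorff_pre_antimono)
    also have "\<dots> \<le> hausdorff_outer n (A \<union> B)"
      using pre[OF \<eta>(1,2)] hausdorff_pre_le_outer[OF \<eta>(1), of n "A \<union> B"] by (rule order_trans)
    finally show ?thesis .
  qed
  have "hausdorff_pre n \<delta> A + hausdorff_outer n B \<le> hausdorff_outer n (A \<union> B)" if "0 < \<delta>" for \<delta>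
    unfolding hausdorff_outer_def[of n B] using *[OF that]
    by (subst ennreal_SUP_add_right) (auto intro!: SUP_least)
  then show ?thesis
    unfolding hausdorff_outer_def[of n A]
    by (subst ennreal_SUP_add_left[symmetric]) (auto intro!: SUP_least)
qed

lemma ennreal_suminf_tail_less:
  fixes h :: "nat \<Rightarrow> ennreal"
  assumes fin: "(\<Sum>i. h i) < top" and e: "0 < e"
  shows "\<exists>k. (\<Sum>j. h (j + k)) \<le> ennreal e"
proof -
  define r where "r i = enn2real (h i)" for i
  have h: "h i = ennreal (r i)" and r0: "r i \<ge> 0" for i
    using ennreal_suminf_lessD[OF fin, of i] by (auto simp: r_def less_top)
  have s: "summable r"
    using fin r0 by (intro summable_suminf_not_top) (auto simp flip: h)
  obtain N where "\<And>k. k \<ge> N \<Longrightarrow> norm (\<Sum>j. r (j + k)) < e"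
    using suminf_exist_split[OF e s] by blast
  from this[of N] have "(\<Sum>j. r (j + N)) \<le> e" by simp
  moreover have "(\<Sum>j. h (j + N)) = ennreal (\<Sum>j. r (j + N))"
    unfolding h using r0 s summable_ignore_initial_segment by (intro suminf_ennreal2) auto
  ultimately have "(\<Sum>j. h (j + N)) \<le> ennreal e" by (simp add: ennreal_leI)
  then show ?thesis by blast
qed

text \<open>For the shells in Caratheodory's criterion: only shells of the same parity are separated from each
other, so only the two partial sums can be bounded directly.\<close>
lemma ennreal_suminf_even_odd_finite:
  fixes h :: "nat \<Rightarrow> ennreal"
  assumes B: "B < top" and ev: "\<And>N. (\<Sum>k<N. h (2*k)) \<le> B" and od: "\<And>N. (\<Sum>k<N. h (2*k+1)) \<le> B"
  shows "(\<Sum>i. h i) < top"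
proof -
  have eq: "(\<Sum>i<2*N. h i) = (\<Sum>k<N. h (2*k)) + (\<Sum>k<N. h (2*k+1))" for N
    by (induction N) (auto simp: algebra_simps)
  have "(\<Sum>i. h i) \<le> B + B"
    unfolding suminf_eq_SUP
  proof (rule SUP_least)
    fix N
    have "(\<Sum>i<N. h i) \<le> (\<Sum>i<2*N. h i)" by (rule sum_mono2) auto
    also have "\<dots> \<le> B + B" unfolding eq by (intro add_mono ev od)
    finally show "(\<Sum>i<N. h i) \<le> B + B" .
  qed
  also have "\<dots> < top" using B by simp
  finally show ?thesis .
qed

text \<open>Caratheodory's criterion.  The part of \<open>E\<close> at distance at least \<open>a k\<close> from \<open>F\<close> is separated from
\<open>F\<close>, so the outer measure is additive there; the remaining part of \<open>E - F\<close> is a union of shells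
whose outer measures form the tail of a convergent series.\<close>
lemma closed_in_hausdorff_sets:
  fixes F :: "'a::metric_space set"
  assumes F: "closed F"
  shows "F \<in> sets (hausdorff_measure n)"
proof (cases "F = {}")
  case False
  let ?H = "hausdorff_outer n :: 'a set \<Rightarrow> ennreal"
  have main: "?H (E \<inter> F) + ?H (E - F) \<le> ?H E" if finE: "?H E < top" for E
  proof (rule ennreal_le_epsilon)
    fix e :: real assume e: "0 < e"
    define a where "a k = 1 / (real k + 1)" for k
    have a_anti: "a j \<le> a i" if "i \<le> j" for i j using that by (auto simp: a_def frac_le)
    have a_less: "a (Suc k) < a k" for k by (auto simp: a_def intro!: divide_strict_left_mono)
    define S where "S k = {x\<in>E. a k \<le> infdist x F}" for k
    \<comment> \<open>Shells two apart are at positive distance from each other, neighbouring shells may touch.\<close>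
    define R where "R k = {x\<in>E. a (Suc k) \<le> infdist x F \<and> infdist x F < a k}" for k
    have partial: "(\<Sum>k<N. ?H (R (2*k+p))) \<le> ?H (\<Union>k<N. R (2*k+p))" for N p
    proof (induction N)
      case (Suc N)
      have "?H (\<Union>k<N. R (2*k+p)) + ?H (R (2*N+p)) \<le> ?H ((\<Union>k<N. R (2*k+p)) \<union> R (2*N+p))"
      proof (cases "N = 0")
        case False
        show ?thesis
        proof (rule hausdorff_outer_separated[of "a (2*N+p-1) - a (2*N+p)"])
          show "0 < a (2*N+p-1) - a (2*N+p)"
            using a_less[of "2*N+p-1"] False by simp
          fix x y assume "x \<in> (\<Union>k<N. R (2*k+p))" and y: "y \<in> R (2*N+p)"
          then obtain k where k: "k < N" "a (Suc (2*k+p)) \<le> infdist x F"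
            by (auto simp: R_def)
          have "a (2*N+p-1) \<le> a (Suc (2*k+p))"
            using k(1) by (intro a_anti) linarith
          then show "a (2*N+p-1) - a (2*N+p) \<le> dist x y"
            using k y infdist_triangle[of x F y] by (auto simp: R_def)
        qed
      qed simp
      also have "(\<Union>k<N. R (2*k+p)) \<union> R (2*N+p) = (\<Union>k<Suc N. R (2*k+p))"
        by (auto simp: less_Suc_eq)
      finally show ?case
        using add_right_mono[OF Suc.IH, of "?H (R (2*N+p))"] unfolding sum.lessThan_Suc
        by (rule order_trans[rotated])
    qed simp
    have bound: "(\<Sum>k<N. ?H (R (2*k+p))) \<le> ?H E" for N p
      using partial by (rule order_trans) (auto intro!: hausdorff_outer_mono simp: R_def)
    have "(\<Sum>i. ?H (R i)) < top"
      using finE bound[where p=0] bound[where p=1] by (intro ennreal_suminf_even_odd_finite) auto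
    then obtain k where k: "(\<Sum>j. ?H (R (j + k))) \<le> ennreal e"
      using ennreal_suminf_tail_less e by blast
    have cover: "E - F \<subseteq> S k \<union> (\<Union>j. R (j + k))"
    proof
      fix x assume x: "x \<in> E - F"
      then have pos: "infdist x F > 0"
        using F False infdist_pos_not_in_closed by blast
      show "x \<in> S k \<union> (\<Union>j. R (j + k))"
      proof (cases "a k \<le> infdist x F")
        case True then show ?thesis using x by (auto simp: S_def)
      next
        case less: False
        define j where "j = (LEAST j. a (Suc (j + k)) \<le> infdist x F)"
        obtain i where "inverse (of_nat (Suc i)) < infdist x F" using pos reals_Archimedean by blast
        then have "a i \<le> infdist x F" by (simp add: a_def field_simps)
        then have "a (Suc (i + k)) \<le> infdist x F"
          using a_anti[of i "Suc (i + k)"] by linarith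
        then have j: "a (Suc (j + k)) \<le> infdist x F"
          unfolding j_def by (rule LeastI)
        have "infdist x F < a (j + k)"
        proof (cases j)
          case 0 then show ?thesis using less by simp
        next
          case (Suc i)
          then have "\<not> a (Suc (i + k)) \<le> infdist x F"
            using not_less_Least[of i "\<lambda>j. a (Suc (j + k)) \<le> infdist x F"] by (simp add: j_def)
          then show ?thesis using Suc by simp
        qed
        then show ?thesis using j x by (auto simp: R_def)
      qed
    qed
    have "?H (E \<inter> F) + ?H (S k) \<le> ?H (E \<inter> F \<union> S k)"
    proof (rule hausdorff_outer_separated[of "a k"])
      show "a k > 0" by (simp add: a_def)
      fix x y assume "x \<in> E \<inter> F" "y \<in> S k"
      then show "a k \<le> dist x y"
        using infdist_le[of x F y] by (auto simp: S_def dist_commute)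
    qed
    also have "\<dots> \<le> ?H E" by (rule hausdorff_outer_mono) (auto simp: S_def)
    finally have 1: "?H (E \<inter> F) + ?H (S k) \<le> ?H E" .
    have "?H (E - F) \<le> ?H (S k \<union> (\<Union>j. R (j + k)))"
      using cover by (rule hausdorff_outer_mono)
    also have "\<dots> \<le> ?H (S k) + ?H (\<Union>j. R (j + k))" by (rule hausdorff_outer_Un)
    also have "\<dots> \<le> ?H (S k) + ennreal e"
      using k hausdorff_outer_UN[of n "\<lambda>j. R (j + k)"] by (intro add_left_mono) (rule order_trans)
    finally have "?H (E \<inter> F) + ?H (E - F) \<le> ?H (E \<inter> F) + (?H (S k) + ennreal e)"
      by (rule add_left_mono)
    also have "\<dots> \<le> ?H E + ennreal e"
      using 1 by (simp add: add.assoc[symmetric] add_right_mono)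
    finally show "?H (E \<inter> F) + ?H (E - F) \<le> ?H E + ennreal e" .
  qed
  have "?H (F \<inter> E) + ?H ((UNIV - F) \<inter> E) = ?H E" for E
  proof (rule antisym)
    have eq: "(UNIV - F) \<inter> E = E - F" "F \<inter> E = E \<inter> F" by auto
    show "?H (F \<inter> E) + ?H ((UNIV - F) \<inter> E) \<le> ?H E"
      using main[of E] unfolding eq by (cases "?H E = top") (auto simp: less_top)
    have "E = (F \<inter> E) \<union> ((UNIV - F) \<inter> E)" by auto
    then show "?H E \<le> ?H (F \<inter> E) + ?H ((UNIV - F) \<inter> E)"
      using hausdorff_outer_Un[of n "F \<inter> E" "(UNIV - F) \<inter> E"] by simp
  qed
  then show ?thesis by (simp add: sets_hausdorff_measure lambda_system_def)
qed simp

lemma borel_subset_hausdorff_sets: "sets borel \<subseteq> sets (hausdorff_measure n)"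
proof -
  have "sigma_sets UNIV (Collect closed) \<subseteq> sets (hausdorff_measure n)"
    using sets.sigma_sets_subset[of "Collect closed" "hausdorff_measure n"] closed_in_hausdorff_sets[of _ n]
    by auto
  then show ?thesis
    by (simp add: borel_eq_closed)
qed

text \<open>Closing a set does not change its diameter, so nearly optimal covers may be taken closed; the hull
is the intersection of such covers along a sequence of scales.\<close>
lemma hausdorff_borel_hull:
  fixes A :: "'a::metric_space set"
  shows "\<exists>B\<in>sets borel. A \<subseteq> B \<and> hausdorff_outer n B = hausdorff_outer n A"
proof (cases "hausdorff_outer n A = top")
  case True
  then show ?thesis
    using hausdorff_outer_mono[of A UNIV n] by (intro bexI[of _ UNIV]) (auto simp: top_unique)
next
  case False
  define e where "e k = 1 / (real k + 1)" for k
  have e0: "e k > 0" for k by (simp add: e_def)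
  have "\<exists>U\<in>hausdorff_covers (e k) A. (\<Sum>i. hausdorff_weight n (U i)) \<le> hausdorff_outer n A + ennreal (e k)" for k
  proof -
    have "hausdorff_pre n (e k) A < hausdorff_outer n A + ennreal (e k)"
      using hausdorff_pre_le_outer[OF e0, of n k A] False e0[of k]
      by (metis ennreal_add_left_cancel_less add.right_neutral ennreal_less_zero_iff le_less_trans infinity_ennreal_def)
    then show ?thesis
      unfolding hausdorff_pre_def INF_less_iff by (auto intro: less_imp_le)
  qed
  then obtain U where U: "\<And>k. U k \<in> hausdorff_covers (e k) A"
    and Ub: "\<And>k. (\<Sum>i. hausdorff_weight n (U k i)) \<le> hausdorff_outer n A + ennreal (e k)"
    by metis
  define B where "B = (\<Inter>k. \<Union>i. closure (U k i))"
  have "A \<subseteq> B"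
  proof (unfold B_def, intro INT_greatest)
    fix k
    have "A \<subseteq> (\<Union>i. U k i)" using U[of k] by (simp add: hausdorff_covers_def)
    also have "\<dots> \<subseteq> (\<Union>i. closure (U k i))" by (intro UN_mono closure_subset) auto
    finally show "A \<subseteq> (\<Union>i. closure (U k i))" .
  qed
  moreover have "B \<in> sets borel"
    unfolding B_def by (intro sets.countable_INT sets.countable_UN) auto
  moreover have "hausdorff_outer n B \<le> hausdorff_outer n A"
    unfolding hausdorff_outer_def[of n B]
  proof (rule SUP_least)
    fix \<delta> :: real assume "\<delta> \<in> {0<..}"
    then have \<delta>: "\<delta> > 0" by simp
    show "hausdorff_pre n \<delta> B \<le> hausdorff_outer n A"
    proof (rule ennreal_le_epsilon)
      fix r :: real assume r: "0 < r"
      obtain k where "inverse (of_nat (Suc k)) < min r \<delta>" 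
        using reals_Archimedean[of "min r \<delta>"] \<delta> r by auto
      then have k: "e k \<le> \<delta>" "e k \<le> r" by (auto simp: e_def field_simps)
      have "(\<lambda>i. closure (U k i)) \<in> hausdorff_covers \<delta> B"
        using U[of k] k by (auto simp: hausdorff_covers_def B_def diameter_closure intro: order_trans)
      then have "hausdorff_pre n \<delta> B \<le> (\<Sum>i. hausdorff_weight n (closure (U k i)))"
        unfolding hausdorff_pre_def by (rule INF_lower)
      also have "\<dots> = (\<Sum>i. hausdorff_weight n (U k i))"
        using U[of k] by (simp add: hausdorff_weight_closure hausdorff_covers_def)
      also have "\<dots> \<le> hausdorff_outer n A + ennreal (e k)" by (rule Ub)
      also have "\<dots> \<le> hausdorff_outer n A + ennreal r"
        using k by (intro add_left_mono ennreal_leI)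
      finally show "hausdorff_pre n \<delta> B \<le> hausdorff_outer n A + ennreal r" .
    qed
  qed
  ultimately show ?thesis
    using hausdorff_outer_mono[of A B n] by (intro bexI[of _ B]) auto
qed

lemma hausdorff_pre_le_finite_sum:
  assumes I: "finite I" and cov: "A \<subseteq> (\<Union>i\<in>I. U i)" and \<delta>: "0 \<le> \<delta>"
    and U: "\<And>i. i \<in> I \<Longrightarrow> bounded (U i)" "\<And>i. i \<in> I \<Longrightarrow> diameter (U i) \<le> \<delta>"
  shows "hausdorff_pre n \<delta> A \<le> (\<Sum>i\<in>I. hausdorff_weight n (U i))"
proof -
  obtain h where h: "bij_betw h {0..<card I} I"
    using ex_bij_betw_nat_finite[OF I] by blast
  define V where "V k = (if k < card I then U (h k) else {})" for k
  have hI: "h k \<in> I" if "k < card I" for k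
    using h that by (auto simp: bij_betw_def)
  have "A \<subseteq> (\<Union>k. V k)"
  proof
    fix x assume "x \<in> A"
    then obtain i where i: "i \<in> I" "x \<in> U i" using cov by blast
    then have "i \<in> h ` {0..<card I}" using h by (auto simp: bij_betw_def)
    then obtain k where "k < card I" "i = h k" by auto
    then have "x \<in> V k" using i by (simp add: V_def)
    then show "x \<in> (\<Union>k. V k)" by blast
  qed
  then have "V \<in> hausdorff_covers \<delta> A"
    using \<delta> U hI by (auto simp: hausdorff_covers_def V_def)
  then have "hausdorff_pre n \<delta> A \<le> (\<Sum>k. hausdorff_weight n (V k))"
    unfolding hausdorff_pre_def by (rule INF_lower)
  also have "\<dots> = (\<Sum>k\<in>{0..<card I}. hausdorff_weight n (V k))"
    by (rule suminf_finite) (auto simp: V_def hausdorff_weight_def)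
  also have "\<dots> = (\<Sum>k\<in>{0..<card I}. hausdorff_weight n (U (h k)))"
    by (rule sum.cong) (auto simp: V_def)
  also have "\<dots> = (\<Sum>i\<in>I. hausdorff_weight n (U i))"
    using h by (rule sum.reindex_bij_betw)
  finally show ?thesis .
qed

text \<open>A grid of mesh \<open>1 / k\<close> divides the face into \<open>(2 * k) ^ n\<close> cubes of diameter at most
\<open>CARD('m) / k\<close>; the total weight of this cover is bounded independently of \<open>k\<close>.\<close>
lemma hausdorff_outer_cube_face_finite:
  fixes i :: "'m::finite"
  assumes dim: "CARD('m) = n + 1"
  shows "hausdorff_outer n {x :: real^'m. x $ i = s \<and> (\<forall>j. \<bar>x $ j\<bar> \<le> 1)} < top" (is "hausdorff_outer n ?F < top")
proof -
  define m where "m = real CARD('m)"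
  have m: "m > 0" by (simp add: m_def)
  define K where "K = 2 ^ n * (unit_ball_vol (real n) * m ^ n)"
  have pre: "hausdorff_pre n \<delta> ?F \<le> ennreal K" if \<delta>: "0 < \<delta>" for \<delta>
  proof -
    obtain k0 :: nat where "m / \<delta> < k0" using reals_Archimedean2 by blast
    then have k0: "m / real (Suc k0) \<le> \<delta>" using \<delta> by (simp add: field_simps)
    define k where "k = Suc k0"
    have k: "k > 0" "m / real k \<le> \<delta>" using k0 by (simp_all add: k_def)
    define I where "I = (PiE (UNIV - {i}) (\<lambda>_. {0..<2*k}) :: ('m \<Rightarrow> nat) set)"
    define B where "B p = {x :: real^'m. x $ i = s \<and> (\<forall>j. j \<noteq> i \<longrightarrow> real (p j) \<le> k * (x $ j + 1) \<and> k * (x $ j + 1) \<le> real (p j) + 1)}"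
      for p :: "'m \<Rightarrow> nat"
    have fI: "finite I" unfolding I_def by (intro finite_PiE) auto
    have cI: "card I = (2*k) ^ n"
      using dim by (simp add: I_def card_PiE)
    have dist: "dist x y \<le> m / k" if "x \<in> B p" "y \<in> B p" for x y p
    proof -
      have "\<bar>(x - y) $ j\<bar> \<le> 1 / k" for j
      proof (cases "j = i")
        case False
        then have "real (p j) \<le> k * (x $ j + 1)" "k * (x $ j + 1) \<le> real (p j) + 1"
           "real (p j) \<le> k * (y $ j + 1)" "k * (y $ j + 1) \<le> real (p j) + 1"
          using that by (auto simp: B_def)
        then have "k * \<bar>x $ j - y $ j\<bar> \<le> 1"
          by (cases "x $ j \<ge> y $ j") (auto simp: algebra_simps)
        then show ?thesis using k by (simp add: field_simps)
      qed (use that in \<open>auto simp: B_def\<close>)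
      then have "(\<Sum>j\<in>UNIV. \<bar>(x - y) $ j\<bar>) \<le> (\<Sum>j\<in>(UNIV::'m set). 1 / k)"
        by (intro sum_mono)
      then show ?thesis
        using norm_le_l1_cart[of "x - y"] by (simp add: dist_norm m_def)
    qed
    have diam: "diameter (B p) \<le> m / k" for p
      using dist m by (intro diameter_le_dist) auto
    have bdd: "bounded (B p)" for p
      using dist unfolding bounded_two_points by blast
    have cov: "?F \<subseteq> (\<Union>p\<in>I. B p)"
    proof
      fix x assume x: "x \<in> ?F"
      have "\<exists>q::nat. q < 2*k \<and> real q \<le> k * (x $ j + 1) \<and> k * (x $ j + 1) \<le> real q + 1" for j
      proof -
        define z where "z = k * (x $ j + 1)"
        have "\<bar>x $ j\<bar> \<le> 1" using x by blast
        then have "0 \<le> x $ j + 1" "x $ j + 1 \<le> 2" by auto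
        then have z: "0 \<le> z" "z \<le> 2 * k"
          using mult_left_mono[of "x $ j + 1" 2 "real k"] by (auto simp: z_def)
        show ?thesis unfolding z_def[symmetric]
        proof (cases "z = 2 * k")
          case True
          then show "\<exists>q::nat. q < 2*k \<and> real q \<le> z \<and> z \<le> real q + 1"
            using k by (intro exI[of _ "2*k-1"]) (auto simp: of_nat_diff)
        next
          case False
          then show "\<exists>q::nat. q < 2*k \<and> real q \<le> z \<and> z \<le> real q + 1"
            using z by (intro exI[of _ "nat \<lfloor>z\<rfloor>"]) (auto; linarith)
        qed
      qed
      then obtain q where q: "\<And>j. q j < 2*k \<and> real (q j) \<le> k * (x $ j + 1) \<and> k * (x $ j + 1) \<le> real (q j) + 1"
        by metis
      have "restrict q (UNIV - {i}) \<in> I" using q by (auto simp: I_def)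
      moreover have "x \<in> B (restrict q (UNIV - {i}))" using x q by (auto simp: B_def)
      ultimately show "x \<in> (\<Union>p\<in>I. B p)" by blast
    qed
    have "hausdorff_pre n \<delta> ?F \<le> (\<Sum>p\<in>I. hausdorff_weight n (B p))"
      using fI cov \<delta> bdd order_trans[OF diam k(2)] by (intro hausdorff_pre_le_finite_sum) auto
    also have "\<dots> \<le> (\<Sum>p\<in>I. ennreal (unit_ball_vol (real n) * (m / k) ^ n))"
    proof (rule sum_mono)
      fix p
      have d: "0 \<le> diameter (B p) / 2" "diameter (B p) / 2 \<le> m / k"
        using diameter_ge_0[OF bdd[of p]] diam[of p] by linarith+
      show "hausdorff_weight n (B p) \<le> ennreal (unit_ball_vol (real n) * (m / k) ^ n)"
        using d by (auto simp: hausdorff_weight_def intro!: ennreal_leI mult_left_mono power_mono)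
    qed
    also have "\<dots> = ennreal (real ((2*k)^n) * (unit_ball_vol (real n) * (m / k) ^ n))"
      using m by (simp add: cI ennreal_mult' ennreal_of_nat_eq_real_of_nat)
    also have "real ((2*k)^n) * (unit_ball_vol (real n) * (m / k) ^ n) = K"
      using k by (simp add: K_def power_mult_distrib power_divide)
    finally show ?thesis .
  qed
  have "hausdorff_outer n ?F \<le> ennreal K"
    unfolding hausdorff_outer_def using pre by (intro SUP_least) auto
  then show ?thesis by (simp add: order.strict_trans1)
qed

lemma dist_sgn_le:
  fixes x y :: "'a::real_inner"
  assumes x: "1 \<le> norm x" and y: "1 \<le> norm y"
  shows "dist (sgn x) (sgn y) \<le> 2 * dist x y"
proof -
  have "norm x * norm (sgn x - sgn y) = norm (norm x *\<^sub>R (sgn x - sgn y))" by simp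
  also have "norm x *\<^sub>R (sgn x - sgn y) = (x - y) + (norm y - norm x) *\<^sub>R sgn y"
  proof -
    have "norm x *\<^sub>R sgn x = x" "norm y *\<^sub>R sgn y = y"
      using x y by (cases "x = 0"; cases "y = 0"; simp add: sgn_div_norm)+
    then show ?thesis by (simp add: algebra_simps)
  qed
  also have "norm \<dots> \<le> norm (x - y) + \<bar>norm y - norm x\<bar> * norm (sgn y)"
    by (metis norm_scaleR norm_triangle_ineq)
  also have "\<dots> \<le> norm (x - y) + norm (x - y)"
    using y norm_triangle_ineq3[of y x] by (auto simp: norm_sgn norm_minus_commute)
  finally have *: "norm x * norm (sgn x - sgn y) \<le> 2 * norm (x - y)" by simp
  have "norm (sgn x - sgn y) \<le> norm x * norm (sgn x - sgn y)"
    using mult_right_mono[OF x norm_ge_zero[of "sgn x - sgn y"]] by simp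
  with * show ?thesis by (simp add: dist_norm)
qed

text \<open>The radial projection \<open>sgn\<close> is Lipschitz outside the unit ball and maps the faces of the cube onto
the sphere.\<close>
lemma hausdorff_outer_usphere_finite:
  assumes dim: "CARD('m::finite) = n + 1"
  shows "hausdorff_outer n (usphere :: (real^'m) set) < top"
proof -
  define F where "F = (\<lambda>(i::'m, s::real). {x :: real^'m. x $ i = s \<and> (\<forall>j. \<bar>x $ j\<bar> \<le> 1)})"
  define P where "P = (UNIV :: 'm set) \<times> {-1, 1::real}"
  have cov: "usphere \<subseteq> (\<Union>p\<in>P. sgn ` F p)"
  proof
    fix x :: "real^'m" assume "x \<in> usphere"
    then have nx: "norm x = 1" by simp
    define t where "t = Max (range (\<lambda>j. \<bar>x $ j\<bar>))"
    have "t \<in> range (\<lambda>j. \<bar>x $ j\<bar>)" unfolding t_def by (intro Max_in) auto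
    then obtain i where i: "t = \<bar>x $ i\<bar>" by auto
    have le: "\<bar>x $ j\<bar> \<le> t" for j unfolding t_def by (intro Max_ge) auto
    have "t \<noteq> 0"
    proof
      assume "t = 0"
      then have "x = 0" using le by (simp add: vec_eq_iff)
      then show False using nx by simp
    qed
    then have t: "t > 0" using i by simp
    have "(1 / t) *\<^sub>R x \<in> F (i, sgn (x $ i))"
    proof -
      have "x $ i / t = sgn (x $ i)" using t i by (auto simp: sgn_if abs_if split: if_splits)
      moreover have "\<bar>x $ j / t\<bar> \<le> 1" for j using le[of j] t by (simp add: abs_divide)
      ultimately show ?thesis by (simp add: F_def)
    qed
    moreover have "sgn ((1 / t) *\<^sub>R x) = x"
      using t nx by (simp add: sgn_div_norm)
    moreover have "(i, sgn (x $ i)) \<in> P"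
      using t i by (auto simp: P_def sgn_if)
    ultimately show "x \<in> (\<Union>p\<in>P. sgn ` F p)"
      by (metis UN_I image_eqI)
  qed
  have fin: "hausdorff_outer n (sgn ` F p) < top" if p: "p \<in> P" for p
  proof -
    obtain i s where [simp]: "p = (i, s)" and s: "\<bar>s\<bar> = 1" using p by (auto simp: P_def)
    have n1: "1 \<le> norm x" if "x \<in> F p" for x
      using that component_le_norm_cart[of x i] s by (auto simp: F_def)
    have "hausdorff_outer n (sgn ` F p) \<le> ennreal (2 ^ n) * hausdorff_outer n (F p)"
      by (rule hausdorff_outer_Lipschitz_image) (auto intro!: dist_sgn_le n1)
    also have "\<dots> < top"
      using hausdorff_outer_cube_face_finite[OF dim, of i s] by (simp add: F_def ennreal_mult_less_top)
    finally show ?thesis .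
  qed
  have "hausdorff_outer n (usphere :: (real^'m) set) \<le> hausdorff_outer n (\<Union>p\<in>P. sgn ` F p)"
    using cov by (rule hausdorff_outer_mono)
  also have "\<dots> \<le> (\<Sum>p\<in>P. hausdorff_outer n (sgn ` F p))"
    by (rule hausdorff_outer_finite_UN) (simp add: P_def)
  also have "\<dots> < top" using fin by (simp add: P_def)
  finally show ?thesis .
qed

section \<open>The surface measure and Borel functions\<close>

lemma space_sphere_measure [simp]: "space (sphere_measure n) = usphere"
  by (simp add: sphere_measure_def space_restrict_space)

lemma usphere_in_hausdorff_sets [simp]: "usphere \<in> sets (hausdorff_measure n)"
  by (rule closed_in_hausdorff_sets) simp

lemma emeasure_sphere_measure:
  assumes "A \<in> sets (sphere_measure n)"
  shows "emeasure (sphere_measure n) A = hausdorff_outer n A"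
proof -
  have A: "A \<in> sets (hausdorff_measure n)" "A \<subseteq> usphere"
    using assms by (auto simp: sphere_measure_def sets_restrict_space_iff)
  then show ?thesis
    by (simp add: sphere_measure_def emeasure_restrict_space emeasure_hausdorff_measure)
qed

lemma measurable_sphere_measure_borel [measurable]: "(\<lambda>x. x) \<in> sphere_measure n \<rightarrow>\<^sub>M borel"
  using borel_subset_hausdorff_sets[of n] unfolding sphere_measure_def
  by (intro measurable_restrict_space1) (auto intro!: measurableI)

lemma borel_Int_usphere_in_sets: "A \<in> sets borel \<Longrightarrow> A \<inter> usphere \<in> sets (sphere_measure n)"
  using borel_subset_hausdorff_sets[of n]
  by (auto simp: sphere_measure_def sets_restrict_space)

text \<open>A Caratheodory-measurable set of finite outer measure differs from its Borel hull by a null set,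
which is itself contained in a Borel null set.  Hence the surface measure is contained in the
completion of its restriction to the Borel sets.\<close>
lemma sphere_measure_borel_version:
  fixes f :: "'a::euclidean_space \<Rightarrow> real"
  assumes f: "f \<in> borel_measurable (sphere_measure n)"
    and fin: "hausdorff_outer n (usphere :: 'a set) < top"
  shows "\<exists>g\<in>borel_measurable borel. AE x in sphere_measure n. f x = g x"
proof -
  let ?M = "sphere_measure n :: 'a measure"
  define D where "D = distr ?M borel (\<lambda>x. x)"
  have eD: "emeasure D A = hausdorff_outer n (A \<inter> usphere)" if "A \<in> sets borel" for A
    using that borel_Int_usphere_in_sets[OF that, of n]
    by (simp add: D_def emeasure_distr emeasure_sphere_measure)
  have finite_sub: "hausdorff_outer n A < top" if "A \<subseteq> usphere" for A :: "'a set"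
    using hausdorff_outer_mono[OF that] fin by (rule order.strict_trans1)
  have compl: "A \<in> sets (completion D)" if A: "A \<in> sets ?M" for A
  proof -
    have sub: "A \<subseteq> usphere" and Ah: "A \<in> sets (hausdorff_measure n)"
      using A by (auto simp: sphere_measure_def sets_restrict_space_iff)
    obtain G where G: "G \<in> sets borel" "A \<subseteq> G" "hausdorff_outer n G = hausdorff_outer n A"
      using hausdorff_borel_hull by blast
    have "hausdorff_outer n (A \<inter> G) + hausdorff_outer n ((UNIV - A) \<inter> G) = hausdorff_outer n G"
      using Ah by (simp add: sets_hausdorff_measure lambda_system_def)
    moreover have "A \<inter> G = A" "(UNIV - A) \<inter> G = G - A" using G by auto
    ultimately have 0: "hausdorff_outer n (G - A) = 0"
      using G(3) finite_sub[OF sub] by (metis add.right_neutral ennreal_add_left_cancel infinity_ennreal_def less_irrefl)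
    obtain Z where Z: "Z \<in> sets borel" "G - A \<subseteq> Z" "hausdorff_outer n Z = 0"
      using hausdorff_borel_hull[of "G - A" n] 0 by metis
    have "hausdorff_outer n (Z \<inter> usphere) = 0"
      using hausdorff_outer_mono[of "Z \<inter> usphere" Z n] Z by simp
    then have "Z \<in> null_sets D"
      using Z by (auto simp: null_sets_def eD) (simp add: D_def)
    then show ?thesis
      using G Z by (intro sets_completionI[of A "G - Z" "A \<inter> Z" Z]) (auto simp: D_def)
  qed
  define f0 where "f0 x = (if x \<in> usphere then f x else 0)" for x
  have "f0 \<in> borel_measurable (completion D)"
  proof (rule measurableI)
    fix T :: "real set" assume T: "T \<in> sets borel"
    have 1: "f -` T \<inter> usphere \<in> sets ?M"
      using measurable_sets[OF f T] by simp
    have "f0 -` T \<inter> space (completion D) = (f -` T \<inter> usphere) \<union> (if 0 \<in> T then - usphere else {})"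
      by (auto simp: f0_def D_def split: if_splits simp del: mem_sphere_0)
    moreover have "- usphere \<in> sets (completion D)"
      by (intro sets_completionI_sets) (simp add: D_def borel_open open_Compl)
    ultimately show "f0 -` T \<inter> space (completion D) \<in> sets (completion D)"
      using compl[OF 1] by auto
  qed simp
  then obtain g where g: "g \<in> borel_measurable D" "AE x in D. f0 x = g x"
    using completion_ex_borel_measurable_real by blast
  have "AE x in ?M. f0 x = g x"
    using g(2) unfolding D_def by (rule AE_distrD[rotated]) measurable
  then have "AE x in ?M. f x = g x"
    by (rule AE_mp) (auto simp: f0_def intro!: AE_I2)
  moreover have "g \<in> borel_measurable borel" using g(1) by (simp add: D_def)
  ultimately show ?thesis by blast
qed

section \<open>Reflections and soft polarization\<close>

definition reflect :: "'a::real_inner \<Rightarrow> 'a \<Rightarrow> 'a" where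
  "reflect u x = x - (2 * (u \<bullet> x)) *\<^sub>R u"

lemma inner_reflect_left: "reflect u x \<bullet> y = x \<bullet> y - 2 * (u \<bullet> x) * (u \<bullet> y)"
  by (simp add: reflect_def inner_diff_left)

lemma inner_reflect_right: "y \<bullet> reflect u x = y \<bullet> x - 2 * (u \<bullet> x) * (u \<bullet> y)"
  by (simp add: reflect_def inner_diff_right inner_commute)

lemma inner_self_reflect: "norm u = 1 \<Longrightarrow> u \<bullet> reflect u x = - (u \<bullet> x)"
  by (simp add: inner_reflect_right flip: power2_norm_eq_inner)

lemma reflect_reflect: "norm u = 1 \<Longrightarrow> reflect u (reflect u x) = x"
  by (simp add: reflect_def[of u "reflect u x"] inner_self_reflect) (simp add: reflect_def)

lemma inner_reflect_swap: "reflect u x \<bullet> y = x \<bullet> reflect u y"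
  by (simp add: inner_reflect_left inner_reflect_right inner_commute mult.commute mult.left_commute)

lemma norm_reflect: "norm u = 1 \<Longrightarrow> norm (reflect u x) = norm x"
  by (simp add: norm_eq_sqrt_inner inner_reflect_swap reflect_reflect)

lemma reflect_in_usphere: "u \<in> usphere \<Longrightarrow> x \<in> usphere \<Longrightarrow> reflect u x \<in> usphere"
  by (simp add: norm_reflect)

lemma measurable_reflect [measurable (raw)]:
  fixes f g :: "'b \<Rightarrow> 'a::euclidean_space"
  assumes [measurable]: "f \<in> borel_measurable N" "g \<in> borel_measurable N"
  shows "(\<lambda>w. reflect (f w) (g w)) \<in> borel_measurable N"
  unfolding reflect_def by measurable

text \<open>The first two branches give the probabilities of the union and of the intersection of independent events
of probabilities \<open>f x\<close> and \<open>f (reflect u x)\<close>.  The sign of \<open>(u \<bullet> x) * (u \<bullet> c)\<close> tells whether \<open>x\<close> lies on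
the side of \<open>c\<close>; a mirror through \<open>c\<close> leaves \<open>f\<close> unchanged.\<close>
definition soft_polarization :: "'a::real_inner \<Rightarrow> 'a \<Rightarrow> ('a \<Rightarrow> real) \<Rightarrow> 'a \<Rightarrow> real" where
  "soft_polarization c u f x =
    (if (u \<bullet> x) * (u \<bullet> c) > 0 then f x + f (reflect u x) - f x * f (reflect u x)
     else if (u \<bullet> x) * (u \<bullet> c) < 0 then f x * f (reflect u x)
     else f x)"

definition unit_valued :: "('a::euclidean_space \<Rightarrow> real) \<Rightarrow> bool" where
  "unit_valued f \<longleftrightarrow> f \<in> borel_measurable borel \<and> (\<forall>x. 0 \<le> f x \<and> f x \<le> 1)"

lemma unit_valuedD:
  assumes "unit_valued f"
  shows "f \<in> borel_measurable borel" "0 \<le> f x" "f x \<le> 1"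
  using assms by (auto simp: unit_valued_def)

lemma unit_valued_indicator: "C \<in> sets borel \<Longrightarrow> unit_valued (indicator C)"
  by (auto simp: unit_valued_def indicator_def)

lemma unit_valued_soft_polarization:
  assumes f: "unit_valued f"
  shows "unit_valued (soft_polarization c u f)"
proof -
  note [measurable] = unit_valuedD(1)[OF f]
  have pq: "0 \<le> p + q - p * q" "p + q - p * q \<le> 1" "0 \<le> p * q" "p * q \<le> 1"
    if "0 \<le> p" "p \<le> 1" "0 \<le> q" "q \<le> 1" for p q :: real
    using that mult_nonneg_nonneg[of "1 - p" "1 - q"] mult_nonneg_nonneg[of p "1 - q"] mult_le_one[of p q]
    by (auto simp: algebra_simps)
  have "0 \<le> soft_polarization c u f x \<and> soft_polarization c u f x \<le> 1" for x
    using pq[of "f x" "f (reflect u x)"] unit_valuedD(2,3)[OF f]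
    by (auto simp: soft_polarization_def)
  moreover have "soft_polarization c u f \<in> borel_measurable borel"
    unfolding soft_polarization_def by measurable
  ultimately show ?thesis by (simp add: unit_valued_def)
qed

lemma soft_polarization_pair_sum:
  assumes u: "norm u = 1"
  shows "soft_polarization c u f x + soft_polarization c u f (reflect u x) = f x + f (reflect u x)"
  using u by (auto simp: soft_polarization_def inner_self_reflect reflect_reflect zero_less_mult_iff mult_less_0_iff)

lemma soft_polarization_ge:
  assumes f: "unit_valued f" and s: "(u \<bullet> x) * (u \<bullet> c) > 0"
  shows "f x \<le> soft_polarization c u f x" "f (reflect u x) \<le> soft_polarization c u f x"
proof -
  note uv = unit_valuedD(2,3)[OF f]
  show "f x \<le> soft_polarization c u f x" "f (reflect u x) \<le> soft_polarization c u f x"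
    using s mult_left_le[of "f x" "f (reflect u x)"] mult_left_le[of "f (reflect u x)" "f x"] uv[of x] uv[of "reflect u x"]
    by (auto simp: soft_polarization_def mult.commute)
qed

lemma soft_polarization_le:
  assumes f: "unit_valued f" and s: "(u \<bullet> x) * (u \<bullet> c) < 0"
  shows "soft_polarization c u f x \<le> f x" "soft_polarization c u f x \<le> f (reflect u x)"
proof -
  note uv = unit_valuedD(2,3)[OF f]
  show "soft_polarization c u f x \<le> f x" "soft_polarization c u f x \<le> f (reflect u x)"
    using s mult_left_le[of "f x" "f (reflect u x)"] mult_left_le[of "f (reflect u x)" "f x"] uv[of x] uv[of "reflect u x"]
    by (auto simp: soft_polarization_def mult.commute)
qed

text \<open>If in each coordinate the pair \<open>(a i, b i)\<close> is replaced by a pair with the same sum whose first entry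
dominates both \<open>a i\<close> and \<open>b i\<close>, then the large factors are collected in one product.  The
induction step is the rearrangement inequality for two pairs of numbers.\<close>
lemma prod_add_prod_le_of_spread:
  fixes a b A B :: "'i \<Rightarrow> real"
  assumes I: "finite I"
    and nonneg: "\<And>i. i \<in> I \<Longrightarrow> 0 \<le> a i \<and> 0 \<le> b i \<and> 0 \<le> B i"
    and sum: "\<And>i. i \<in> I \<Longrightarrow> a i + b i = A i + B i"
    and dom: "\<And>i. i \<in> I \<Longrightarrow> a i \<le> A i \<and> b i \<le> A i"
  shows "(\<Prod>i\<in>I. a i) + (\<Prod>i\<in>I. b i) \<le> (\<Prod>i\<in>I. A i) + (\<Prod>i\<in>I. B i)"
  using assms
proof (induction I rule: finite_induct)
  case (insert j I)
  define p q P Q where "p = (\<Prod>i\<in>I. a i)" "q = (\<Prod>i\<in>I. b i)" "P = (\<Prod>i\<in>I. A i)" "Q = (\<Prod>i\<in>I. B i)"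
  note defs = this
  have IH: "p + q \<le> P + Q" unfolding defs using insert by (intro insert.IH) auto
  have BA: "0 \<le> B i" "B i \<le> A i" if "i \<in> insert j I" for i
    using insert.prems(1,2,3)[OF that] by linarith+
  have "p \<le> P" "q \<le> P" "Q \<le> P"
    unfolding defs using insert.prems BA by (auto intro!: prod_mono)
  moreover have j: "0 \<le> a j" "0 \<le> b j" "0 \<le> B j" "a j + b j = A j + B j" "a j \<le> A j" "b j \<le> A j"
    using insert.prems by auto
  ultimately have "a j * p + b j * q \<le> A j * P + B j * Q"
  proof -
    assume le: "p \<le> P" "q \<le> P" "Q \<le> P"
    have *: "s * p' + t * q' \<le> A j * P + B j * Q"
      if "t \<le> s" "0 \<le> t" "s + t = A j + B j" "s \<le> A j" "p' \<le> P" "p' + q' \<le> P + Q" for s t p' q'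
    proof -
      have "s * p' + t * q' = t * (p' + q') + (s - t) * p'" by (simp add: algebra_simps)
      also have "\<dots> \<le> t * (P + Q) + (s - t) * P"
        by (rule add_mono[OF mult_left_mono mult_left_mono]) (use that in auto)
      also have "\<dots> = s * P + t * Q" by (simp add: algebra_simps)
      also have "\<dots> \<le> A j * P + B j * Q"
      proof -
        have "A j * P + B j * Q - (s * P + t * Q) = (A j - s) * P + (B j - t) * Q"
          by (simp add: algebra_simps)
        also have "B j - t = - (A j - s)" using that by simp
        also have "(A j - s) * P + - (A j - s) * Q = (A j - s) * (P - Q)"
          by (simp add: algebra_simps)
        also have "\<dots> \<ge> 0" using that le by (intro mult_nonneg_nonneg) auto
        finally show ?thesis by simp
      qed
      finally show ?thesis .
    qed
    show ?thesis
      using *[of "b j" "a j" p q] *[of "a j" "b j" q p] j le IH by (cases "b j \<le> a j") (auto simp: algebra_simps)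
  qed
  then show ?case using insert by (simp add: defs)
qed simp

section \<open>Measures on the sphere invariant under reflections\<close>

text \<open>The last assumption compares the distribution of \<open>reflect u x\<close>, for a random normal \<open>u\<close> and fixed \<open>x\<close>, with
the measure itself.  Both assumptions on reflections speak of Borel sets, as their preimages under the continuous map
\<open>(u, x) \<mapsto> reflect u x\<close> are Borel again, while \<open>M\<close> may have further measurable sets.\<close>
locale reflection_invariant = finite_measure M
  for M :: "'a::euclidean_space measure" and \<kappa> :: real +
  assumes space_M: "space M = usphere"
    and id_measurable [measurable]: "(\<lambda>x. x) \<in> M \<rightarrow>\<^sub>M borel"
    and emeasure_reflect: "\<And>u A. u \<in> usphere \<Longrightarrow> A \<in> sets borel \<Longrightarrow>
      emeasure M (reflect u -` A \<inter> usphere) = emeasure M (A \<inter> usphere)"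
    and \<kappa>_pos: "0 < \<kappa>"
    and emeasure_reflect_normals: "\<And>x A. x \<in> usphere \<Longrightarrow> A \<in> sets borel \<Longrightarrow>
      ennreal \<kappa> * emeasure M (A \<inter> usphere) \<le> emeasure M {u \<in> usphere. reflect u x \<in> A}"
begin

lemma borel_measurable_M [measurable (raw)]: "f \<in> borel_measurable borel \<Longrightarrow> f \<in> borel_measurable M"
  using measurable_compose[OF id_measurable] by blast

lemma integrable_bounded_borel:
  fixes f :: "'a \<Rightarrow> real"
  assumes "f \<in> borel_measurable M" "\<And>x. x \<in> usphere \<Longrightarrow> \<bar>f x\<bar> \<le> B"
  shows "integrable M f"
  using assms by (intro integrable_const_bound[of _ B]) (auto simp: space_M)

lemma integral_reflect:
  fixes f :: "'a \<Rightarrow> real"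
  assumes u: "u \<in> usphere" and [measurable]: "f \<in> borel_measurable borel"
  shows "(\<integral>x. f (reflect u x) \<partial>M) = (\<integral>x. f x \<partial>M)"
proof -
  have "distr M borel (reflect u) = distr M borel (\<lambda>x. x)"
  proof (rule measure_eqI)
    fix A assume "A \<in> sets (distr M borel (reflect u))"
    then have A: "A \<in> sets borel" by simp
    have "emeasure M (reflect u -` A \<inter> usphere) = emeasure M (A \<inter> usphere)"
      using u A by (rule emeasure_reflect)
    then show "emeasure (distr M borel (reflect u)) A = emeasure (distr M borel (\<lambda>x. x)) A"
      using A by (simp add: emeasure_distr space_M)
  qed simp
  then have "(\<integral>x. f x \<partial>distr M borel (reflect u)) = (\<integral>x. f x \<partial>distr M borel (\<lambda>x. x))"
    by simp
  then show ?thesis by (simp add: integral_distr)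
qed

text \<open>Lets the sign of \<open>\<integral> d * \<phi>\<close> be read off pointwise, by comparing \<open>\<phi>\<close> at a point and at its mirror image.\<close>
lemma integral_antisymmetric:
  fixes d \<phi> :: "'a \<Rightarrow> real"
  assumes u: "u \<in> usphere" and [measurable]: "d \<in> borel_measurable borel" "\<phi> \<in> borel_measurable borel"
    and B: "\<And>x. x \<in> usphere \<Longrightarrow> \<bar>d x\<bar> \<le> 1" "\<And>x. x \<in> usphere \<Longrightarrow> \<bar>\<phi> x\<bar> \<le> 1"
    and anti: "\<And>x. x \<in> usphere \<Longrightarrow> d (reflect u x) = - d x"
  shows "(\<integral>x. d x * (\<phi> x - \<phi> (reflect u x)) \<partial>M) = 2 * (\<integral>x. d x * \<phi> x \<partial>M)"
proof -
  have bound: "\<bar>s * t\<bar> \<le> 1" if "\<bar>s\<bar> \<le> 1" "\<bar>t\<bar> \<le> 1" for s t :: real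
    using that by (simp add: abs_mult mult_le_one)
  have 1: "integrable M (\<lambda>x. d x * \<phi> x)"
    using B bound by (intro integrable_bounded_borel[where B=1]) auto
  have 2: "integrable M (\<lambda>x. d x * \<phi> (reflect u x))"
    using B bound reflect_in_usphere[OF u] by (intro integrable_bounded_borel[where B=1]) (auto simp del: mem_sphere_0)
  have "(\<integral>x. d x * \<phi> (reflect u x) \<partial>M) = (\<integral>x. - (d (reflect u x) * \<phi> (reflect u x)) \<partial>M)"
    using anti by (intro Bochner_Integration.integral_cong) (auto simp: space_M)
  also have "\<dots> = - (\<integral>x. d x * \<phi> x \<partial>M)"
    using integral_reflect[OF u, of "\<lambda>x. d x * \<phi> x"] by simp
  finally show ?thesis
    using 1 2 by (simp add: right_diff_distrib)
qed

section \<open>Polarization increases the polar functional\<close>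

definition hemi :: "('a \<Rightarrow> real) \<Rightarrow> 'a \<Rightarrow> real" where
  "hemi f y = (\<integral>x. f x * indicator {x. x \<bullet> y \<le> 0} x \<partial>M)"

lemma integrable_hemi:
  assumes "unit_valued f"
  shows "integrable M (\<lambda>x. f x * indicator {x. x \<bullet> y \<le> 0} x)"
proof -
  note [measurable] = unit_valuedD(1)[OF assms]
  show ?thesis
    using unit_valuedD(2,3)[OF assms]
    by (intro integrable_bounded_borel[where B=1]) (auto simp: indicator_def)
qed

lemma integrable_unit_valued: "unit_valued f \<Longrightarrow> integrable M f"
  by (rule integrable_bounded_borel[where B=1]) (auto simp: unit_valued_def)

lemma hemi_nonneg: "unit_valued f \<Longrightarrow> 0 \<le> hemi f y"
  unfolding hemi_def by (intro integral_nonneg_AE) (auto simp: unit_valued_def)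

lemma hemi_le: assumes "unit_valued f" shows "hemi f y \<le> measure M usphere"
proof -
  have "hemi f y \<le> (\<integral>x. 1 \<partial>M)"
    unfolding hemi_def using unit_valuedD[OF assms]
    by (intro integral_mono integrable_hemi assms) (auto simp: indicator_def)
  then show ?thesis by (simp add: space_M)
qed

lemma measurable_hemi [measurable (raw)]:
  assumes "unit_valued f" "g \<in> borel_measurable N"
  shows "(\<lambda>w. hemi f (g w)) \<in> borel_measurable N"
proof -
  note [measurable] = unit_valuedD(1)[OF assms(1)] assms(2)
  have "(\<lambda>(y, x). f x * indicator {x. x \<bullet> y \<le> 0} x) \<in> borel_measurable (borel \<Otimes>\<^sub>M M)"
    unfolding indicator_def by measurable
  then have "(\<lambda>y. hemi f y) \<in> borel_measurable borel"
    unfolding hemi_def by (rule borel_measurable_lebesgue_integral)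
  then show ?thesis by measurable
qed

text \<open>Moving the reflection from \<open>y\<close> to \<open>f\<close> reduces statements about \<open>hemi f\<close> at mirror points to pointwise
statements about \<open>f\<close>.\<close>
lemma hemi_reflect:
  assumes u: "u \<in> usphere" and f: "unit_valued f"
  shows "hemi f (reflect u y) = (\<integral>x. f (reflect u x) * indicator {x. x \<bullet> y \<le> 0} x \<partial>M)"
proof -
  note [measurable] = unit_valuedD(1)[OF f]
  have "hemi f (reflect u y) = (\<integral>x. f (reflect u (reflect u x)) * indicator {x. x \<bullet> y \<le> 0} (reflect u x) \<partial>M)"
    unfolding hemi_def using u
    by (intro Bochner_Integration.integral_cong)
       (auto simp: reflect_reflect indicator_def simp flip: inner_reflect_swap)
  also have "\<dots> = (\<integral>x. f (reflect u x) * indicator {x. x \<bullet> y \<le> 0} x \<partial>M)"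
    by (rule integral_reflect[OF u, of "\<lambda>x. f (reflect u x) * indicator {x. x \<bullet> y \<le> 0} x"]) measurable
  finally show ?thesis .
qed

lemma integrable_hemi_reflect:
  assumes u: "u \<in> usphere" and f: "unit_valued f"
  shows "integrable M (\<lambda>x. f (reflect u x) * indicator {x. x \<bullet> y \<le> 0} x)"
proof -
  note [measurable] = unit_valuedD(1)[OF f]
  show ?thesis
    using unit_valuedD(2,3)[OF f]
    by (intro integrable_bounded_borel[where B=1]) (auto simp: indicator_def)
qed

lemma hemi_soft_polarization_pair_sum:
  assumes u: "u \<in> usphere" and f: "unit_valued f"
  shows "hemi (soft_polarization c u f) y + hemi (soft_polarization c u f) (reflect u y)
    = hemi f y + hemi f (reflect u y)"
proof -
  let ?k = "indicator {x. x \<bullet> y \<le> 0} :: 'a \<Rightarrow> real"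
  have *: "hemi g y + hemi g (reflect u y) = (\<integral>x. (g x + g (reflect u x)) * ?k x \<partial>M)" if "unit_valued g" for g
    unfolding hemi_reflect[OF u that]
    using integrable_hemi[OF that, of y] integrable_hemi_reflect[OF u that, of y]
    by (simp add: hemi_def distrib_right)
  show ?thesis
    using u by (simp add: * f unit_valued_soft_polarization soft_polarization_pair_sum)
qed

text \<open>Both differences are integrals of an antisymmetric function against the indicator of the hemisphere
opposite to \<open>y\<close>.  The antisymmetric function is nonnegative on the side of \<open>c\<close>; and since \<open>y\<close> lies on
the other side, \<open>x\<close> belongs to that hemisphere whenever \<open>x\<close> is on the side of \<open>c\<close> and its mirror image
belongs to it.\<close>
lemma hemi_soft_polarization_ge:
  assumes u: "u \<in> usphere" and f: "unit_valued f" and y: "(u \<bullet> y) * (u \<bullet> c) < 0"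
  shows "hemi f y \<le> hemi (soft_polarization c u f) y"
    and "hemi f (reflect u y) \<le> hemi (soft_polarization c u f) y"
proof -
  let ?P = "soft_polarization c u f" and ?k = "indicator {x. x \<bullet> y \<le> 0} :: 'a \<Rightarrow> real"
  note fP = unit_valued_soft_polarization[OF f, of c u]
  note [measurable] = unit_valuedD(1)[OF f] unit_valuedD(1)[OF fP]
  note bnd = unit_valuedD(2,3)[OF f] unit_valuedD(2,3)[OF fP]
  have n: "norm u = 1" using u by simp
  have k: "?k (reflect u x) \<le> ?k x" if "(u \<bullet> x) * (u \<bullet> c) > 0" for x
    using that y by (auto simp: indicator_def inner_reflect_left zero_less_mult_iff mult_less_0_iff)
      (smt (verit) mult_pos_neg mult_neg_pos)+
  have k': "?k x \<le> ?k (reflect u x)" if "(u \<bullet> x) * (u \<bullet> c) < 0" for x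
    using k[of "reflect u x"] that n by (simp add: inner_self_reflect reflect_reflect)
  have sign: "0 \<le> d x * (?k x - ?k (reflect u x))"
    if d: "\<And>x. (u \<bullet> x) * (u \<bullet> c) > 0 \<Longrightarrow> 0 \<le> d x" "\<And>x. (u \<bullet> x) * (u \<bullet> c) < 0 \<Longrightarrow> d x \<le> 0" for d x
  proof -
    consider "(u \<bullet> x) * (u \<bullet> c) > 0" | "(u \<bullet> x) * (u \<bullet> c) < 0" | "u \<bullet> x = 0"
      using y by force
    then show ?thesis
    proof cases
      case 1 then show ?thesis using d(1)[OF 1] k[OF 1] by simp
    next
      case 2 then show ?thesis using d(2)[OF 2] k'[OF 2] by (intro mult_nonpos_nonpos) auto
    next
      case 3 then show ?thesis by (simp add: reflect_def)
    qed
  qed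
  have key: "0 \<le> (\<integral>x. d x * ?k x \<partial>M)"
    if [measurable]: "d \<in> borel_measurable borel" and "\<And>x. \<bar>d x\<bar> \<le> 1" "\<And>x. d (reflect u x) = - d x"
      "\<And>x. (u \<bullet> x) * (u \<bullet> c) > 0 \<Longrightarrow> 0 \<le> d x" "\<And>x. (u \<bullet> x) * (u \<bullet> c) < 0 \<Longrightarrow> d x \<le> 0" for d
  proof -
    have "0 \<le> (\<integral>x. d x * (?k x - ?k (reflect u x)) \<partial>M)"
      using sign that(4,5) by (intro integral_nonneg_AE) auto
    also have "\<dots> = 2 * (\<integral>x. d x * ?k x \<partial>M)"
      using that by (intro integral_antisymmetric[OF u]) (auto simp: indicator_def)
    finally show ?thesis by simp
  qed
  have "0 \<le> (\<integral>x. (?P x - f x) * ?k x \<partial>M)"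
  proof (rule key)
    fix x
    show "\<bar>?P x - f x\<bar> \<le> 1" using bnd(1,2)[of x] bnd(3,4)[of x] by auto
    show "?P (reflect u x) - f (reflect u x) = - (?P x - f x)"
      using soft_polarization_pair_sum[OF n, of c f x] by simp
  qed (use soft_polarization_ge[OF f] soft_polarization_le[OF f] in auto)
  then show "hemi f y \<le> hemi ?P y"
    using integrable_hemi[OF f, of y] integrable_hemi[OF fP, of y] by (simp add: hemi_def left_diff_distrib)
  have "0 \<le> (\<integral>x. (?P x - f (reflect u x)) * ?k x \<partial>M)"
  proof (rule key)
    fix x
    show "\<bar>?P x - f (reflect u x)\<bar> \<le> 1" using bnd(1,2)[of "reflect u x"] bnd(3,4)[of x] by auto
    show "?P (reflect u x) - f (reflect u (reflect u x)) = - (?P x - f (reflect u x))"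
      using soft_polarization_pair_sum[OF n, of c f x] n by (simp add: reflect_reflect)
  qed (use soft_polarization_ge[OF f] soft_polarization_le[OF f] in auto)
  then show "hemi f (reflect u y) \<le> hemi ?P y"
    using integrable_hemi_reflect[OF u f, of y] integrable_hemi[OF fP, of y]
    by (simp add: hemi_reflect[OF u f] left_diff_distrib) (simp add: hemi_def)
qed

definition polar_functional :: "'i set \<Rightarrow> ('i \<Rightarrow> 'a \<Rightarrow> real) \<Rightarrow> real" where
  "polar_functional I f = (\<integral>y. (\<Prod>i\<in>I. hemi (f i) y) \<partial>M)"

lemma prod_hemi:
  assumes f: "\<And>i. i \<in> I \<Longrightarrow> unit_valued (f i)"
  shows "(\<lambda>y. \<Prod>i\<in>I. hemi (f i) y) \<in> borel_measurable borel"
    and "\<bar>\<Prod>i\<in>I. hemi (f i) y\<bar> \<le> measure M usphere ^ card I"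
    and "integrable M (\<lambda>y. \<Prod>i\<in>I. hemi (f i) y)"
proof -
  show 1: "(\<lambda>y. \<Prod>i\<in>I. hemi (f i) y) \<in> borel_measurable borel"
    using f by (intro borel_measurable_prod measurable_hemi) auto
  show 2: "\<bar>\<Prod>i\<in>I. hemi (f i) y\<bar> \<le> measure M usphere ^ card I" for y
  proof -
    have "(\<Prod>i\<in>I. hemi (f i) y) \<le> (\<Prod>i\<in>I. measure M usphere)"
      using f by (intro prod_mono) (auto simp: hemi_nonneg hemi_le)
    moreover have "0 \<le> (\<Prod>i\<in>I. hemi (f i) y)"
      using f by (intro prod_nonneg) (auto simp: hemi_nonneg)
    ultimately show ?thesis by simp
  qed
  show "integrable M (\<lambda>y. \<Prod>i\<in>I. hemi (f i) y)"
    using 1 2 by (intro integrable_bounded_borel) auto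
qed

text \<open>Averaging the integrand over \<open>y\<close> and its mirror image reduces the claim to a pointwise inequality
between sums of two products, in which all factors are pushed apart in the same direction.\<close>
lemma polar_functional_soft_polarization:
  fixes I :: "'i set"
  assumes u: "u \<in> usphere" and I: "finite I" and f: "\<And>i. i \<in> I \<Longrightarrow> unit_valued (f i)"
  shows "polar_functional I f \<le> polar_functional I (\<lambda>i. soft_polarization c u (f i))"
proof -
  have n: "norm u = 1" using u by simp
  define F where "F f y = (\<Prod>i\<in>I. hemi (f i) y)" for f :: "'i \<Rightarrow> 'a \<Rightarrow> real" and y
  let ?P = "\<lambda>i. soft_polarization c u (f i)"
  have P: "unit_valued (?P i)" if "i \<in> I" for i using f[OF that] by (rule unit_valued_soft_polarization)
  have avg: "2 * polar_functional I g = (\<integral>y. F g y + F g (reflect u y) \<partial>M)"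
    and int: "integrable M (\<lambda>y. F g y + F g (reflect u y))"
    if g: "\<And>i. i \<in> I \<Longrightarrow> unit_valued (g i)" for g
  proof -
    note F = prod_hemi[of I g, OF g, folded F_def]
    note [measurable] = F(1)
    have i2: "integrable M (\<lambda>y. F g (reflect u y))"
      using F(2) by (intro integrable_bounded_borel) auto
    show "2 * polar_functional I g = (\<integral>y. F g y + F g (reflect u y) \<partial>M)"
      using integral_reflect[OF u F(1)] F(3) i2 by (simp add: polar_functional_def F_def[symmetric])
    show "integrable M (\<lambda>y. F g y + F g (reflect u y))" using F(3) i2 by simp
  qed
  have step: "F f y + F f (reflect u y) \<le> F ?P y + F ?P (reflect u y)" if y: "(u \<bullet> y) * (u \<bullet> c) < 0" for y
    unfolding F_def
  proof (rule prod_add_prod_le_of_spread[OF I])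
    fix i assume i: "i \<in> I"
    show "0 \<le> hemi (f i) y \<and> 0 \<le> hemi (f i) (reflect u y) \<and> 0 \<le> hemi (?P i) (reflect u y)"
      using f[OF i] P[OF i] by (simp add: hemi_nonneg)
    show "hemi (f i) y + hemi (f i) (reflect u y) = hemi (?P i) y + hemi (?P i) (reflect u y)"
      using hemi_soft_polarization_pair_sum[OF u f[OF i]] by simp
    show "hemi (f i) y \<le> hemi (?P i) y \<and> hemi (f i) (reflect u y) \<le> hemi (?P i) y"
      using hemi_soft_polarization_ge[OF u f[OF i] y] by simp
  qed
  have "F f y + F f (reflect u y) \<le> F ?P y + F ?P (reflect u y)" for y
  proof -
    consider "(u \<bullet> y) * (u \<bullet> c) < 0" | "(u \<bullet> y) * (u \<bullet> c) > 0" | "u \<bullet> y = 0" | "u \<bullet> c = 0"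
      by fastforce
    then show ?thesis
    proof cases
      case 2
      then show ?thesis
        using step[of "reflect u y"] n by (simp add: inner_self_reflect reflect_reflect)
    next
      case 3
      then have "reflect u y = y" by (simp add: reflect_def)
      then show ?thesis
        using hemi_soft_polarization_pair_sum[OF u f, of _ c y] by (simp add: F_def)
    next
      case 4
      then have "?P = f" by (simp add: soft_polarization_def fun_eq_iff)
      then show ?thesis by simp
    qed (rule step)
  qed
  then have "(\<integral>y. F f y + F f (reflect u y) \<partial>M) \<le> (\<integral>y. F ?P y + F ?P (reflect u y) \<partial>M)"
    by (intro integral_mono int f P) auto
  then show ?thesis
    using avg[of f] avg[of ?P] f P by simp
qed

lemma integral_soft_polarization:
  assumes u: "u \<in> usphere" and f: "unit_valued f"
  shows "(\<integral>x. soft_polarization c u f x \<partial>M) = (\<integral>x. f x \<partial>M)"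
proof -
  have n: "norm u = 1" using u by simp
  have avg: "2 * (\<integral>x. g x \<partial>M) = (\<integral>x. g x + g (reflect u x) \<partial>M)" if "unit_valued g" for g
  proof -
    note [measurable] = unit_valuedD(1)[OF that]
    have "integrable M (\<lambda>x. g (reflect u x))"
      using unit_valuedD(2,3)[OF that] by (intro integrable_bounded_borel[where B=1]) auto
    then show ?thesis
      using integrable_unit_valued[OF that] integral_reflect[OF u unit_valuedD(1)[OF that]] by simp
  qed
  have "2 * (\<integral>x. soft_polarization c u f x \<partial>M) = 2 * (\<integral>x. f x \<partial>M)"
    unfolding avg[OF f] avg[OF unit_valued_soft_polarization[OF f]] soft_polarization_pair_sum[OF n] ..
  then show ?thesis by simp
qed

section \<open>Random reflections move mass into the caps\<close>

text \<open>The lower bound for the distribution of \<open>reflect u x\<close>, passed from sets to functions.\<close>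
lemma integral_over_normals:
  assumes x: "x \<in> usphere" and b: "unit_valued b"
  shows "\<kappa> * (\<integral>y. b y \<partial>M) \<le> (\<integral>u. b (reflect u x) \<partial>M)"
proof -
  note [measurable] = unit_valuedD(1)[OF b]
  have b0: "0 \<le> b y" for y using unit_valuedD(2)[OF b] .
  let ?D = "distr M borel (\<lambda>y. y)" and ?R = "distr M borel (\<lambda>u. reflect u x)"
  have le: "scale_measure (ennreal \<kappa>) ?D \<le> ?R"
  proof (subst le_measure)
    show "\<forall>A\<in>sets (scale_measure (ennreal \<kappa>) ?D). emeasure (scale_measure (ennreal \<kappa>) ?D) A \<le> emeasure ?R A"
    proof
      fix A assume "A \<in> sets (scale_measure (ennreal \<kappa>) ?D)"
      then have A: "A \<in> sets borel" by simp
      have "(\<lambda>u. reflect u x) -` A \<inter> usphere = {u \<in> usphere. reflect u x \<in> A}" by auto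
      then show "emeasure (scale_measure (ennreal \<kappa>) ?D) A \<le> emeasure ?R A"
        using emeasure_reflect_normals[OF x A] A by (simp add: emeasure_distr space_M)
    qed
  qed simp
  have "(\<integral>\<^sup>+y. ennreal (b y) \<partial>scale_measure (ennreal \<kappa>) ?D) \<le> (\<integral>\<^sup>+y. ennreal (b y) \<partial>?R)"
    using le by (intro nn_integral_mono_measure) auto
  then have "ennreal \<kappa> * (\<integral>\<^sup>+y. ennreal (b y) \<partial>M) \<le> (\<integral>\<^sup>+u. ennreal (b (reflect u x)) \<partial>M)"
    by (simp add: nn_integral_scale_measure nn_integral_distr)
  moreover have "(\<integral>\<^sup>+y. ennreal (b y) \<partial>M) = ennreal (\<integral>y. b y \<partial>M)"
    using integrable_unit_valued[OF b] b0 by (intro nn_integral_eq_integral) auto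
  moreover have "(\<integral>\<^sup>+u. ennreal (b (reflect u x)) \<partial>M) = ennreal (\<integral>u. b (reflect u x) \<partial>M)"
    using unit_valuedD(2,3)[OF b]
    by (intro nn_integral_eq_integral integrable_bounded_borel[where B=1]) auto
  ultimately show ?thesis
    using \<kappa>_pos b0 by (simp add: integral_nonneg_AE flip: ennreal_mult')
qed

text \<open>Fubini's theorem: a random reflection matches the mass of \<open>a\<close> with the mass of \<open>b\<close> at least \<open>\<kappa>\<close>
times as well as independent points would.\<close>
lemma integral_pairs_over_normals:
  assumes a: "unit_valued a" and b: "unit_valued b"
  shows "\<kappa> * ((\<integral>x. a x \<partial>M) * (\<integral>x. b x \<partial>M)) \<le> (\<integral>u. (\<integral>x. a x * b (reflect u x) \<partial>M) \<partial>M)"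
    and "integrable M (\<lambda>u. \<integral>x. a x * b (reflect u x) \<partial>M)"
proof -
  note [measurable] = unit_valuedD(1)[OF a] unit_valuedD(1)[OF b]
  note bnd = unit_valuedD(2,3)[OF a] unit_valuedD(2,3)[OF b]
  interpret P: pair_sigma_finite M M ..
  interpret PP: finite_measure "M \<Otimes>\<^sub>M M"
    by (rule finite_measure_pair_measure) unfold_locales
  have int: "integrable (M \<Otimes>\<^sub>M M) (\<lambda>(u, x). a x * b (reflect u x))"
    using bnd by (intro PP.integrable_const_bound[where B=1]) (auto simp: mult_le_one)
  show int2: "integrable M (\<lambda>u. \<integral>x. a x * b (reflect u x) \<partial>M)"
    using P.integrable_fst[OF int] by simp
  have "\<kappa> * ((\<integral>x. a x \<partial>M) * (\<integral>x. b x \<partial>M)) = (\<integral>x. a x * (\<kappa> * (\<integral>x. b x \<partial>M)) \<partial>M)"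
    by simp
  also have "\<dots> \<le> (\<integral>x. a x * (\<integral>u. b (reflect u x) \<partial>M) \<partial>M)"
  proof (rule integral_mono)
    show "integrable M (\<lambda>x. a x * (\<kappa> * (\<integral>x. b x \<partial>M)))"
      using integrable_unit_valued[OF a] by simp
    show "integrable M (\<lambda>x. a x * (\<integral>u. b (reflect u x) \<partial>M))"
      using P.integrable_snd[OF int] by simp
    show "a x * (\<kappa> * (\<integral>x. b x \<partial>M)) \<le> a x * (\<integral>u. b (reflect u x) \<partial>M)" if "x \<in> space M" for x
      using integral_over_normals[OF _ b, of x] that bnd by (intro mult_left_mono) (auto simp: space_M)
  qed
  also have "\<dots> = (\<integral>x. (\<integral>u. a x * b (reflect u x) \<partial>M) \<partial>M)" by simp
  also have "\<dots> = (\<integral>u. (\<integral>x. a x * b (reflect u x) \<partial>M) \<partial>M)"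
    using P.Fubini_integral[OF int] by simp
  finally show "\<kappa> * ((\<integral>x. a x \<partial>M) * (\<integral>x. b x \<partial>M)) \<le> (\<integral>u. (\<integral>x. a x * b (reflect u x) \<partial>M) \<partial>M)" .
qed

text \<open>Covers open and closed caps alike: within the sphere, \<open>C\<close> contains with any point all points
that are at least as close to \<open>c\<close>.\<close>
definition cap_about :: "'a \<Rightarrow> 'a set \<Rightarrow> bool" where
  "cap_about c C \<longleftrightarrow> C \<in> sets borel \<and> (\<forall>x\<in>C \<inter> usphere. \<forall>y\<in>usphere - C. c \<bullet> y < c \<bullet> x)"

lemma unit_valued_mult: "unit_valued f \<Longrightarrow> unit_valued g \<Longrightarrow> unit_valued (\<lambda>x. f x * g x)"
  by (auto simp: unit_valued_def mult_le_one)

lemma unit_valued_compl: "unit_valued f \<Longrightarrow> unit_valued (\<lambda>x. 1 - f x)"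
  by (auto simp: unit_valued_def)

text \<open>The change \<open>d\<close> of \<open>f\<close> is antisymmetric, so its integral over \<open>C\<close> is one half of the integral of
\<open>d x * (indicator C x - indicator C (reflect u x))\<close>.  As \<open>C\<close> prefers points close to \<open>c\<close>, both factors have
the same sign everywhere, and for \<open>x \<in> C\<close>, \<open>reflect u x \<notin> C\<close> the product is
\<open>(1 - f x) * f (reflect u x)\<close>.\<close>
lemma cap_mass_gain:
  assumes u: "u \<in> usphere" and f: "unit_valued f" and C: "cap_about c C"
  shows "(\<integral>x. (indicator C x * (1 - f x)) * (indicator (- C) (reflect u x) * f (reflect u x)) \<partial>M)
    \<le> 2 * ((\<integral>x. indicator C x * soft_polarization c u f x \<partial>M) - (\<integral>x. indicator C x * f x \<partial>M))"
    (is "(\<integral>x. ?g x \<partial>M) \<le> _")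
proof -
  have n: "norm u = 1" using u by simp
  let ?P = "soft_polarization c u f"
  have Cb [measurable]: "C \<in> sets borel" using C by (simp add: cap_about_def)
  note fP = unit_valued_soft_polarization[OF f, of c u]
  note [measurable] = unit_valuedD(1)[OF f] unit_valuedD(1)[OF fP]
  note bnd = unit_valuedD(2,3)[OF f] unit_valuedD(2,3)[OF fP]
  define d where "d x = ?P x - f x" for x
  have [measurable]: "d \<in> borel_measurable borel" unfolding d_def by measurable
  have d1: "\<bar>d x\<bar> \<le> 1" for x using bnd(1,2)[of x] bnd(3,4)[of x] by (auto simp: d_def)
  have danti: "d (reflect u x) = - d x" for x
    using soft_polarization_pair_sum[OF n, of c f x] by (simp add: d_def)
  have pw: "?g x \<le> d x * (indicator C x - indicator C (reflect u x))" if x: "x \<in> usphere" for x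
  proof -
    have rx: "reflect u x \<in> usphere" using u x by (rule reflect_in_usphere)
    have c1: "(u \<bullet> x) * (u \<bullet> c) > 0" if "x \<in> C" "reflect u x \<notin> C"
    proof -
      have "c \<bullet> reflect u x < c \<bullet> x"
        using C that x rx unfolding cap_about_def by blast
      then show ?thesis
        by (auto simp: inner_reflect_right mult.assoc zero_less_mult_iff mult_less_0_iff)
    qed
    have c2: "(u \<bullet> x) * (u \<bullet> c) < 0" if "x \<notin> C" "reflect u x \<in> C"
    proof -
      have "c \<bullet> x < c \<bullet> reflect u x"
        using C that x rx unfolding cap_about_def by blast
      then show ?thesis
        by (auto simp: inner_reflect_right mult.assoc zero_less_mult_iff mult_less_0_iff)
    qed
    show ?thesis
    proof (cases "x \<in> C"; cases "reflect u x \<in> C")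
      assume a: "x \<in> C" "reflect u x \<notin> C"
      show ?thesis using a c1[OF a] by (simp add: d_def soft_polarization_def algebra_simps)
    next
      assume a: "x \<notin> C" "reflect u x \<in> C"
      have "d x \<le> 0" using soft_polarization_le(1)[OF f c2[OF a]] by (simp add: d_def)
      then show ?thesis using a by simp
    qed auto
  qed
  have "(\<integral>x. ?g x \<partial>M) \<le> (\<integral>x. d x * (indicator C x - indicator C (reflect u x)) \<partial>M)"
  proof (rule integral_mono)
    show "integrable M ?g"
      using bnd by (intro integrable_bounded_borel[where B=1]) (auto simp: indicator_def mult_le_one)
    show "integrable M (\<lambda>x. d x * (indicator C x - indicator C (reflect u x)))"
      using d1 by (intro integrable_bounded_borel[where B=1]) (auto simp: indicator_def)
  qed (use pw in \<open>auto simp: space_M\<close>)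
  also have "\<dots> = 2 * (\<integral>x. d x * indicator C x \<partial>M)"
    using d1 danti by (intro integral_antisymmetric[OF u]) (auto simp: indicator_def)
  also have "(\<integral>x. d x * indicator C x \<partial>M) = (\<integral>x. indicator C x * ?P x - indicator C x * f x \<partial>M)"
    by (intro Bochner_Integration.integral_cong) (auto simp: d_def algebra_simps)
  also have "\<dots> = (\<integral>x. indicator C x * ?P x \<partial>M) - (\<integral>x. indicator C x * f x \<partial>M)"
    using unit_valued_mult[OF unit_valued_indicator[OF Cb] f] unit_valued_mult[OF unit_valued_indicator[OF Cb] fP]
    by (intro Bochner_Integration.integral_diff integrable_unit_valued)
  finally show ?thesis by simp
qed

section \<open>Convergence to the caps\<close>

text \<open>For \<open>f i\<close> with values in \<open>[0, 1]\<close> and of the same mass as \<open>indicator (C i)\<close> this is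
half the \<open>L\<^sup>1\<close> distance between the two, summed over \<open>i\<close>.\<close>
definition deficit :: "'i set \<Rightarrow> ('i \<Rightarrow> 'a set) \<Rightarrow> ('i \<Rightarrow> 'a \<Rightarrow> real) \<Rightarrow> real" where
  "deficit I C f = (\<Sum>i\<in>I. \<integral>x. indicator (C i) x * (1 - f i x) \<partial>M)"

definition competitor :: "'i set \<Rightarrow> ('i \<Rightarrow> 'a set) \<Rightarrow> ('i \<Rightarrow> 'a \<Rightarrow> real) \<Rightarrow> bool" where
  "competitor I C f \<longleftrightarrow> (\<forall>i\<in>I. unit_valued (f i) \<and> (\<integral>x. f i x \<partial>M) = (\<integral>x. indicator (C i) x \<partial>M))"

lemma mass_outside_cap:
  assumes f: "unit_valued f" and C [measurable]: "C \<in> sets borel" and eq: "(\<integral>x. f x \<partial>M) = (\<integral>x. indicator C x \<partial>M)"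
  shows "(\<integral>x. indicator (- C) x * f x \<partial>M) = (\<integral>x. indicator C x * (1 - f x) \<partial>M)"
proof -
  have i: "integrable M (\<lambda>x. indicator C x * f x)" "integrable M f" "integrable M (indicator C :: 'a \<Rightarrow> real)"
    by (intro integrable_unit_valued unit_valued_mult unit_valued_indicator C f)+
  have "(\<integral>x. indicator (- C) x * f x \<partial>M) = (\<integral>x. f x - indicator C x * f x \<partial>M)"
    by (intro Bochner_Integration.integral_cong) (auto simp: indicator_def)
  also have "\<dots> = (\<integral>x. indicator C x - indicator C x * f x \<partial>M)"
    using i eq by simp
  also have "\<dots> = (\<integral>x. indicator C x * (1 - f x) \<partial>M)"
    by (intro Bochner_Integration.integral_cong) (auto simp: algebra_simps)
  finally show ?thesis .
qed

lemma deficit_nonneg: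
  assumes "competitor I C f"
  shows "0 \<le> deficit I C f"
  unfolding deficit_def using assms
  by (intro sum_nonneg integral_nonneg_AE) (auto simp: competitor_def unit_valued_def)

lemma competitor_soft_polarization:
  "u \<in> usphere \<Longrightarrow> competitor I C f \<Longrightarrow> competitor I C (\<lambda>i. soft_polarization c u (f i))"
  by (simp add: competitor_def unit_valued_soft_polarization integral_soft_polarization del: mem_sphere_0)

text \<open>The expected gain of a random reflection is at least \<open>\<kappa> / 2\<close> times the sum of the squares of the
individual deficits, and by the Cauchy-Schwarz inequality this is at least a multiple of the square of the total
deficit.  The constant \<open>\<theta>\<close> absorbs the total measure, which enters as the normals are not
normalised to a probability measure, and the number of functions; adding one to both keeps the
denominator positive.\<close>
lemma exists_improving_reflection:
  fixes I :: "'i set"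
  assumes I: "finite I" and C: "\<And>i. i \<in> I \<Longrightarrow> cap_about c (C i)" and f: "competitor I C f"
  defines "\<theta> \<equiv> \<kappa> / (4 * (measure M usphere + 1) * (card I + 1))"
  shows "\<exists>u\<in>usphere. deficit I C (\<lambda>i. soft_polarization c u (f i)) \<le> deficit I C f - \<theta> * (deficit I C f)\<^sup>2"
proof -
  let ?V = "measure M usphere" and ?D = "deficit I C f"
  have \<theta>: "0 \<le> \<theta>" using \<kappa>_pos by (simp add: \<theta>_def)
  define a b where "a i x = indicator (C i) x * (1 - f i x)" and "b i x = indicator (- C i) x * f i x" for i x
  define G where "G u = (\<Sum>i\<in>I. \<integral>x. a i x * b i (reflect u x) \<partial>M)" for u
  define m where "m i = (\<integral>x. a i x \<partial>M)" for i
  have uv: "unit_valued (f i)" if "i \<in> I" for i using f that by (simp add: competitor_def)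
  have Cb: "C i \<in> sets borel" if "i \<in> I" for i using C[OF that] by (simp add: cap_about_def)
  have a: "unit_valued (a i)" and b: "unit_valued (b i)" if "i \<in> I" for i
    using uv[OF that] Cb[OF that] unfolding a_def b_def
    by (auto intro!: unit_valued_mult unit_valued_indicator unit_valued_compl)
  have mb: "(\<integral>x. b i x \<partial>M) = m i" if "i \<in> I" for i
    using f that unfolding m_def a_def b_def
    by (intro mass_outside_cap uv Cb) (auto simp: competitor_def)
  have D: "?D = (\<Sum>i\<in>I. m i)" by (simp add: deficit_def m_def a_def)
  have drop: "deficit I C (\<lambda>i. soft_polarization c u (f i)) \<le> ?D - G u / 2" if u: "u \<in> usphere" for u
  proof -
    have "(\<integral>x. indicator (C i) x * (1 - soft_polarization c u (f i) x) \<partial>M) \<le> m i - (\<integral>x. a i x * b i (reflect u x) \<partial>M) / 2"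
      if i: "i \<in> I" for i
    proof -
      have split: "(\<integral>x. indicator (C i) x * (1 - g x) \<partial>M) = (\<integral>x. indicator (C i) x \<partial>M) - (\<integral>x. indicator (C i) x * g x \<partial>M)"
        if "unit_valued g" for g
        unfolding right_diff_distrib mult_1_right
        by (intro Bochner_Integration.integral_diff integrable_unit_valued unit_valued_mult unit_valued_indicator Cb i that)
      show ?thesis
        using cap_mass_gain[OF u uv[OF i] C[OF i]]
        unfolding m_def a_def b_def split[OF uv[OF i]] split[OF unit_valued_soft_polarization[OF uv[OF i]]]
        by simp
    qed
    then show ?thesis
      unfolding deficit_def[of I C "\<lambda>i. soft_polarization c u (f i)"] D G_def sum_divide_distrib sum_subtractf[symmetric]
      by (rule sum_mono)
  qed
  have intG: "integrable M G"
    unfolding G_def using integral_pairs_over_normals(2)[OF a b] by (intro Bochner_Integration.integrable_sum) auto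
  have G0: "0 \<le> G u" for u
    unfolding G_def using unit_valuedD(2)[OF a] unit_valuedD(2)[OF b]
    by (intro sum_nonneg integral_nonneg_AE) auto
  have "\<exists>u\<in>usphere. 2 * (\<theta> * ?D\<^sup>2) \<le> G u"
  proof (rule ccontr)
    assume "\<not> ?thesis"
    then have less: "G u < 2 * (\<theta> * ?D\<^sup>2)" if "u \<in> usphere" for u using that by (auto simp: not_le simp del: mem_sphere_0)
    obtain u0 :: 'a where "u0 \<in> usphere" using SOME_Basis norm_Basis mem_sphere_0 by blast
    then have pos: "0 < \<theta> * ?D\<^sup>2" using less[of u0] G0[of u0] by linarith
    have "\<kappa> * (\<Sum>i\<in>I. (m i)\<^sup>2) = (\<Sum>i\<in>I. \<kappa> * ((\<integral>x. a i x \<partial>M) * (\<integral>x. b i x \<partial>M)))"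
      using mb by (simp add: sum_distrib_left power2_eq_square flip: m_def)
    also have "\<dots> \<le> (\<Sum>i\<in>I. \<integral>u. (\<integral>x. a i x * b i (reflect u x) \<partial>M) \<partial>M)"
      using integral_pairs_over_normals(1)[OF a b] by (intro sum_mono) auto
    also have "\<dots> = (\<integral>u. G u \<partial>M)"
      unfolding G_def using integral_pairs_over_normals(2)[OF a b]
      by (intro Bochner_Integration.integral_sum[symmetric]) auto
    also have "\<dots> \<le> (\<integral>u. 2 * (\<theta> * ?D\<^sup>2) \<partial>M)"
      using less by (intro integral_mono intG) (auto simp: space_M less_imp_le)
    also have "\<dots> = 2 * (\<theta> * ?D\<^sup>2) * ?V" by (simp add: space_M)
    finally have 1: "\<kappa> * (\<Sum>i\<in>I. (m i)\<^sup>2) \<le> 2 * (\<theta> * ?D\<^sup>2) * ?V" .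
    have 2: "?D\<^sup>2 \<le> card I * (\<Sum>i\<in>I. (m i)\<^sup>2)"
      unfolding D using sum_squared_le_sum_of_squares[of m I] by (simp add: mult.commute)
    also have "\<dots> \<le> (card I + 1) * (\<Sum>i\<in>I. (m i)\<^sup>2)"
      by (intro mult_right_mono sum_nonneg) auto
    finally have "\<kappa> * ?D\<^sup>2 \<le> (card I + 1) * (\<kappa> * (\<Sum>i\<in>I. (m i)\<^sup>2))"
      using \<kappa>_pos by (simp add: mult.left_commute mult_left_mono)
    also have "\<dots> \<le> (card I + 1) * (2 * (\<theta> * ?D\<^sup>2) * ?V)"
      using 1 by (intro mult_left_mono) auto
    also have "\<dots> \<le> (card I + 1) * (2 * (\<theta> * ?D\<^sup>2) * (?V + 1))"
      using pos by (intro mult_left_mono) auto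
    also have "\<dots> = ((card I + 1) * (?V + 1) * \<theta>) * 2 * ?D\<^sup>2" by (simp only: ac_simps)
    also have "(card I + 1) * (?V + 1) * \<theta> = \<kappa> / 4"
    proof -
      have "N * W * (\<kappa> / (4 * W * N)) = \<kappa> / 4" if "0 < W" "0 < N" for W N :: real
        using that by (simp add: field_simps)
      from this[of "?V + 1" "card I + 1"] show ?thesis
        using measure_nonneg[of M usphere] by (simp add: \<theta>_def add_nonneg_pos)
    qed
    finally have "\<kappa> * ?D\<^sup>2 \<le> \<kappa> / 2 * ?D\<^sup>2" by simp
    moreover have "0 < \<kappa> * ?D\<^sup>2" using pos \<kappa>_pos \<theta> by (simp add: zero_less_mult_iff)
    ultimately show False by simp
  qed
  then obtain u where u: "u \<in> usphere" "2 * (\<theta> * ?D\<^sup>2) \<le> G u" by blast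
  then have "deficit I C (\<lambda>i. soft_polarization c u (f i)) \<le> ?D - \<theta> * ?D\<^sup>2"
    using drop[OF u(1)] by linarith
  then show ?thesis using u(1) by blast
qed

text \<open>The infimum of the deficits of all competitors at least as good as \<open>f\<close> is zero: a competitor
that nearly attains a positive infimum would be improved below it by a reflection.\<close>
lemma exists_small_deficit:
  fixes I :: "'i set"
  assumes I: "finite I" and C: "\<And>i. i \<in> I \<Longrightarrow> cap_about c (C i)" and f: "competitor I C f" and e: "0 < e"
  shows "\<exists>g. competitor I C g \<and> polar_functional I f \<le> polar_functional I g \<and> deficit I C g < e"
proof -
  define \<theta> where "\<theta> = \<kappa> / (4 * (measure M usphere + 1) * (card I + 1))"
  have \<theta>: "0 < \<theta>" using \<kappa>_pos measure_nonneg[of M usphere] by (simp add: \<theta>_def add_nonneg_pos)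
  define S where "S = {deficit I C g | g. competitor I C g \<and> polar_functional I f \<le> polar_functional I g}"
  have S0: "S \<noteq> {}" using f by (auto simp: S_def)
  have lb: "bdd_below S" unfolding S_def by (rule bdd_belowI[of _ 0]) (auto intro: deficit_nonneg)
  have nn: "0 \<le> Inf S" using S0 by (rule cInf_greatest) (auto simp: S_def intro: deficit_nonneg)
  have "Inf S = 0"
  proof (rule ccontr)
    assume "Inf S \<noteq> 0"
    then have d: "0 < Inf S" using nn by simp
    then have "Inf S < Inf S + \<theta> * (Inf S)\<^sup>2" using \<theta> by simp
    then obtain s where "s \<in> S" "s < Inf S + \<theta> * (Inf S)\<^sup>2"
      using cInf_less_iff[OF S0 lb] by blast
    then obtain g where g: "competitor I C g" "polar_functional I f \<le> polar_functional I g"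
      and less: "deficit I C g < Inf S + \<theta> * (Inf S)\<^sup>2"
      by (auto simp: S_def)
    have ge: "Inf S \<le> deficit I C g" using g lb by (intro cInf_lower) (auto simp: S_def)
    obtain u where u: "u \<in> usphere"
      and imp: "deficit I C (\<lambda>i. soft_polarization c u (g i)) \<le> deficit I C g - \<theta> * (deficit I C g)\<^sup>2"
      using exists_improving_reflection[OF I C g(1)] unfolding \<theta>_def by blast
    have "polar_functional I g \<le> polar_functional I (\<lambda>i. soft_polarization c u (g i))"
      using g by (intro polar_functional_soft_polarization u I) (auto simp: competitor_def)
    then have "deficit I C (\<lambda>i. soft_polarization c u (g i)) \<in> S"
      using g competitor_soft_polarization[OF u g(1)] unfolding S_def by fastforce
    then have "Inf S \<le> deficit I C (\<lambda>i. soft_polarization c u (g i))"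
      using lb by (rule cInf_lower)
    also have "\<dots> \<le> deficit I C g - \<theta> * (Inf S)\<^sup>2"
      using imp ge d \<theta> by (smt (verit) mult_left_mono power_mono)
    finally show False using less by simp
  qed
  then show ?thesis
    using cInf_less_iff[OF S0 lb, of e] e by (auto simp: S_def)
qed

text \<open>Since \<open>f\<close> and the indicator have equal mass, \<open>f\<close> has as much mass outside \<open>C\<close> as it misses inside.\<close>
lemma hemi_diff_le:
  assumes f: "unit_valued f" and C [measurable]: "C \<in> sets borel" and eq: "(\<integral>x. f x \<partial>M) = (\<integral>x. indicator C x \<partial>M)"
  shows "\<bar>hemi f y - hemi (indicator C) y\<bar> \<le> 2 * (\<integral>x. indicator C x * (1 - f x) \<partial>M)"
proof -
  let ?k = "indicator {x. x \<bullet> y \<le> 0} :: 'a \<Rightarrow> real"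
  note [measurable] = unit_valuedD(1)[OF f]
  have i: "integrable M (\<lambda>x. indicator C x * (1 - f x))" "integrable M (\<lambda>x. indicator (- C) x * f x)"
    by (intro integrable_unit_valued unit_valued_mult unit_valued_indicator unit_valued_compl f, measurable)+
  have bnd: "\<bar>(f x - indicator C x) * ?k x\<bar> \<le> 1" for x
    using unit_valuedD(2,3)[OF f, of x] by (auto simp: indicator_def)
  have "hemi f y - hemi (indicator C) y = (\<integral>x. (f x - indicator C x) * ?k x \<partial>M)"
    using integrable_hemi[OF f, of y] integrable_hemi[OF unit_valued_indicator[OF C], of y]
    by (simp add: hemi_def left_diff_distrib)
  also have "\<bar>\<dots>\<bar> \<le> (\<integral>x. \<bar>(f x - indicator C x) * ?k x\<bar> \<partial>M)"
    by (rule integral_abs_bound)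
  also have "\<dots> \<le> (\<integral>x. indicator C x * (1 - f x) + indicator (- C) x * f x \<partial>M)"
  proof (rule integral_mono)
    show "integrable M (\<lambda>x. \<bar>(f x - indicator C x) * ?k x\<bar>)"
      using bnd by (intro integrable_bounded_borel[where B=1]) auto
    show "integrable M (\<lambda>x. indicator C x * (1 - f x) + indicator (- C) x * f x)"
      using i by simp
  qed (use unit_valuedD(2,3)[OF f] in \<open>auto simp: indicator_def abs_if\<close>)
  also have "\<dots> = 2 * (\<integral>x. indicator C x * (1 - f x) \<partial>M)"
    using i mass_outside_cap[OF f C eq] by simp
  finally show ?thesis .
qed

lemma polar_functional_le_deficit:
  fixes I :: "'i set"
  assumes I: "finite I" and C: "\<And>i. i \<in> I \<Longrightarrow> C i \<in> sets borel" and g: "competitor I C g"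
  defines "V \<equiv> measure M usphere + 1"
  shows "polar_functional I g \<le> polar_functional I (\<lambda>i. indicator (C i)) + 2 * V ^ card I * deficit I C g"
proof -
  have V: "V \<ge> 1" by (simp add: V_def)
  have guv: "unit_valued (g i)" and cuv: "unit_valued (indicator (C i))" if "i \<in> I" for i
    using g C that by (auto simp: competitor_def unit_valued_indicator)
  have le: "(\<Prod>i\<in>I. hemi (g i) y) \<le> (\<Prod>i\<in>I. hemi (indicator (C i)) y) + 2 * V ^ card I / V * deficit I C g" for y
  proof -
    have s: "norm (hemi h y / V) \<le> 1" if "unit_valued h" for h
      using hemi_nonneg[OF that, of y] hemi_le[OF that, of y] V by (simp add: V_def)
    \<comment> \<open>Division by \<open>V\<close> brings the factors into the unit interval, where products are \<open>1\<close>-Lipschitz in each factor.\<close>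
    have "norm ((\<Prod>i\<in>I. hemi (g i) y / V) - (\<Prod>i\<in>I. hemi (indicator (C i)) y / V))
        \<le> (\<Sum>i\<in>I. norm (hemi (g i) y / V - hemi (indicator (C i)) y / V))"
      using guv cuv by (intro norm_prod_diff s)
    also have "\<dots> \<le> (\<Sum>i\<in>I. 2 * (\<integral>x. indicator (C i) x * (1 - g i x) \<partial>M) / V)"
    proof (rule sum_mono)
      fix i assume i: "i \<in> I"
      have "\<bar>hemi (g i) y - hemi (indicator (C i)) y\<bar> \<le> 2 * (\<integral>x. indicator (C i) x * (1 - g i x) \<partial>M)"
        using g i by (intro hemi_diff_le guv C) (auto simp: competitor_def)
      then show "norm (hemi (g i) y / V - hemi (indicator (C i)) y / V) \<le> 2 * (\<integral>x. indicator (C i) x * (1 - g i x) \<partial>M) / V"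
        using V by (simp add: divide_right_mono flip: diff_divide_distrib)
    qed
    also have "\<dots> = 2 / V * deficit I C g"
      by (simp add: deficit_def sum_distrib_left sum_divide_distrib)
    finally have "(\<Prod>i\<in>I. hemi (g i) y / V) - (\<Prod>i\<in>I. hemi (indicator (C i)) y / V) \<le> 2 / V * deficit I C g"
      by simp
    then have "((\<Prod>i\<in>I. hemi (g i) y) - (\<Prod>i\<in>I. hemi (indicator (C i)) y)) / V ^ card I \<le> 2 / V * deficit I C g"
      by (simp add: prod_dividef diff_divide_distrib)
    then show ?thesis using V by (simp add: field_simps)
  qed
  have "polar_functional I g \<le> (\<integral>y. (\<Prod>i\<in>I. hemi (indicator (C i)) y) + 2 * V ^ card I / V * deficit I C g \<partial>M)"
    unfolding polar_functional_def using le guv cuv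
    by (intro integral_mono prod_hemi Bochner_Integration.integrable_add) auto
  also have "\<dots> = polar_functional I (\<lambda>i. indicator (C i)) + 2 * V ^ card I / V * deficit I C g * measure M usphere"
    unfolding polar_functional_def using prod_hemi(3)[of I "\<lambda>i. indicator (C i)"] cuv by (simp add: space_M)
  also have "2 * V ^ card I / V * deficit I C g * measure M usphere \<le> 2 * V ^ card I / V * deficit I C g * V"
    using deficit_nonneg[OF g] V by (intro mult_left_mono) (auto simp: V_def)
  also have "\<dots> = 2 * V ^ card I * deficit I C g" using V by simp
  finally show ?thesis by simp
qed

text \<open>Competitors of arbitrarily small deficit are at least as good as \<open>f\<close>, and their functional exceeds
that of the caps by at most a constant times the deficit.\<close>
theorem polar_functional_le_caps:
  fixes I :: "'i set"
  assumes I: "finite I" and C: "\<And>i. i \<in> I \<Longrightarrow> cap_about c (C i)"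
    and f: "\<And>i. i \<in> I \<Longrightarrow> unit_valued (f i)"
    and mass: "\<And>i. i \<in> I \<Longrightarrow> (\<integral>x. f i x \<partial>M) = measure M (C i \<inter> usphere)"
  shows "polar_functional I f \<le> polar_functional I (\<lambda>i. indicator (C i))"
proof (rule field_le_epsilon)
  fix e :: real assume e: "0 < e"
  define K where "K = 2 * (measure M usphere + 1) ^ card I"
  have K: "0 < K" using measure_nonneg[of M usphere] by (simp add: K_def add_nonneg_pos)
  have "competitor I C f" using f mass by (simp add: competitor_def space_M)
  then have "\<exists>g. competitor I C g \<and> polar_functional I f \<le> polar_functional I g \<and> deficit I C g < e / K"
    using e K by (intro exists_small_deficit[OF I C]) auto
  then obtain g where g: "competitor I C g" "polar_functional I f \<le> polar_functional I g" "deficit I C g < e / K"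
    by blast
  have "polar_functional I g \<le> polar_functional I (\<lambda>i. indicator (C i)) + K * deficit I C g"
    unfolding K_def using C by (intro polar_functional_le_deficit I g(1)) (auto simp: cap_about_def)
  also have "K * deficit I C g \<le> e" using g(3) K by (simp add: field_simps)
  finally show "polar_functional I f \<le> polar_functional I (\<lambda>i. indicator (C i)) + e"
    using g(2) by simp
qed

end

section \<open>Reflection invariance of the surface measure\<close>

text \<open>With \<open>reflect_onto_usphere\<close> this is what bounds the distribution of a randomly reflected point from below.\<close>
lemma dist_reflect_normals_le:
  assumes "norm u = 1" "norm v = 1" "norm x = 1"
  shows "dist (reflect u x) (reflect v x) \<le> 4 * dist u v"
proof -
  have "reflect v x - reflect u x = (2 * (u \<bullet> x)) *\<^sub>R (u - v) + (2 * ((u - v) \<bullet> x)) *\<^sub>R v"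
    by (simp add: reflect_def algebra_simps)
  then have "norm (reflect v x - reflect u x) \<le> 2 * \<bar>u \<bullet> x\<bar> * norm (u - v) + 2 * \<bar>(u - v) \<bullet> x\<bar> * norm v"
    using norm_triangle_ineq[of "(2 * (u \<bullet> x)) *\<^sub>R (u - v)" "(2 * ((u - v) \<bullet> x)) *\<^sub>R v"]
    by (simp add: abs_mult)
  also have "\<dots> \<le> 2 * 1 * norm (u - v) + 2 * norm (u - v) * norm v"
    using Cauchy_Schwarz_ineq2[of u x] Cauchy_Schwarz_ineq2[of "u - v" x] assms
    by (intro add_mono mult_right_mono) auto
  finally show ?thesis using assms by (simp add: dist_norm norm_minus_commute)
qed

text \<open>Distinct \<open>x\<close> and \<open>y\<close> are exchanged by the reflection in their bisecting hyperplane; \<open>x\<close> itself is fixed by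
the mirrors that contain it, which exist as the dimension is at least two.\<close>
lemma reflect_onto_usphere:
  assumes DIM: "2 \<le> DIM('a::euclidean_space)" and x: "x \<in> usphere" and y: "y \<in> usphere"
  shows "\<exists>u\<in>usphere. reflect u x = (y :: 'a)"
proof (cases "x = y")
  case True
  obtain w where "w \<noteq> 0" "orthogonal x w"
    using orthogonal_to_vector_exists[OF DIM, of x] by blast
  then have "norm (sgn w) = 1" "x \<bullet> sgn w = 0"
    by (simp_all add: norm_sgn sgn_div_norm orthogonal_def)
  then obtain a where a: "norm a = 1" "x \<bullet> a = 0" by blast
  then show ?thesis using True by (intro bexI[of _ a]) (auto simp: reflect_def inner_commute)
next
  case False
  define u where "u = sgn (x - y)"
  have "2 * ((x - y) \<bullet> x) = (x - y) \<bullet> (x - y)"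
    using x y by (simp add: inner_diff_left inner_diff_right inner_commute norm_eq_1)
  moreover have "u \<bullet> x = ((x - y) \<bullet> x) / norm (x - y)"
    by (simp add: u_def sgn_div_norm divide_inverse_commute)
  ultimately have "2 * (u \<bullet> x) * norm (x - y) = (norm (x - y))\<^sup>2"
    using False by (simp add: power2_norm_eq_inner)
  then have "2 * (u \<bullet> x) = norm (x - y)" using False by (simp add: power2_eq_square)
  then have "reflect u x = y"
    using False by (simp add: reflect_def u_def sgn_div_norm)
  moreover have "u \<in> usphere" using False by (simp add: u_def norm_sgn)
  ultimately show ?thesis by blast
qed

text \<open>Both properties come from the Lipschitz estimate for Hausdorff measure: reflections and their
inverses are isometries, and \<open>u \<mapsto> reflect u x\<close> is a \<open>4\<close>-Lipschitz map onto the sphere.\<close>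
lemma reflection_invariant_sphere_measure:
  assumes dim: "CARD('m::finite) = n + 1" and n: "n \<ge> 1"
  shows "reflection_invariant (sphere_measure n :: (real^'m) measure) (1 / 4 ^ n)"
proof -
  let ?M = "sphere_measure n :: (real^'m) measure"
  have em: "emeasure ?M (A \<inter> usphere) = hausdorff_outer n (A \<inter> usphere)" if "A \<in> sets borel" for A :: "(real^'m) set"
    using borel_Int_usphere_in_sets[OF that] by (rule emeasure_sphere_measure)
  show ?thesis
  proof (intro reflection_invariant.intro reflection_invariant_axioms.intro finite_measureI)
    have "emeasure ?M (UNIV \<inter> usphere) < top"
      using em[of UNIV] hausdorff_outer_usphere_finite[OF dim] by simp
    then show "emeasure ?M (space ?M) \<noteq> \<infinity>" by simp
  next
    show "space ?M = usphere" by simp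
    show "(\<lambda>x. x) \<in> ?M \<rightarrow>\<^sub>M borel" by measurable
    show "0 < (1 / 4 ^ n :: real)" by simp
  next
    fix u :: "real^'m" and A :: "(real^'m) set" assume u: "u \<in> usphere" and A [measurable]: "A \<in> sets borel"
    have B: "reflect u -` A \<in> sets borel"
      using measurable_sets[of "reflect u" borel borel A] by simp
    have iso: "dist (reflect u x) (reflect u y) = dist x y" for x y
    proof -
      have "reflect u x - reflect u y = reflect u (x - y)" by (simp add: reflect_def algebra_simps)
      then show ?thesis using u by (simp add: dist_norm norm_reflect)
    qed
    have le: "hausdorff_outer n (reflect u ` T) \<le> hausdorff_outer n T" for T
      using hausdorff_outer_Lipschitz_image[of 1 T "reflect u" n] iso by simp
    have 1: "reflect u ` (A \<inter> usphere) = reflect u -` A \<inter> usphere"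
    proof (intro equalityI subsetI)
      fix x assume "x \<in> reflect u -` A \<inter> usphere"
      then have "reflect u x \<in> A \<inter> usphere" "x = reflect u (reflect u x)"
        using u by (auto simp: reflect_reflect norm_reflect)
      then show "x \<in> reflect u ` (A \<inter> usphere)" by (rule rev_image_eqI)
    qed (use u in \<open>auto simp: reflect_reflect norm_reflect\<close>)
    have 2: "reflect u ` (reflect u -` A \<inter> usphere) = A \<inter> usphere"
      using u unfolding 1[symmetric] image_image by (simp add: reflect_reflect)
    show "emeasure ?M (reflect u -` A \<inter> usphere) = emeasure ?M (A \<inter> usphere)"
      unfolding em[OF A] em[OF B]
      using le[of "A \<inter> usphere"] le[of "reflect u -` A \<inter> usphere"] unfolding 1 2 by (rule antisym)
  next
    fix x :: "real^'m" and A :: "(real^'m) set" assume x: "x \<in> usphere" and A [measurable]: "A \<in> sets borel"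
    let ?N = "{u \<in> usphere. reflect u x \<in> A}"
    have B: "(\<lambda>u. reflect u x) -` A \<in> sets borel"
      using measurable_sets[of "\<lambda>u. reflect u x" borel borel A] by simp
    have N: "?N = (\<lambda>u. reflect u x) -` A \<inter> usphere" by auto
    have "A \<inter> usphere \<subseteq> (\<lambda>u. reflect u x) ` ?N"
      using reflect_onto_usphere[OF _ x] dim n by force
    then have "hausdorff_outer n (A \<inter> usphere) \<le> hausdorff_outer n ((\<lambda>u. reflect u x) ` ?N)"
      by (rule hausdorff_outer_mono)
    also have "\<dots> \<le> ennreal (4 ^ n) * hausdorff_outer n ?N"
      using x by (intro hausdorff_outer_Lipschitz_image dist_reflect_normals_le) auto
    finally have "emeasure ?M (A \<inter> usphere) \<le> ennreal (4 ^ n) * emeasure ?M ?N"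
      unfolding N em[OF A] em[OF B] .
    then have "ennreal (1 / 4 ^ n) * emeasure ?M (A \<inter> usphere) \<le> ennreal (1 / 4 ^ n) * (ennreal (4 ^ n) * emeasure ?M ?N)"
      by (rule mult_left_mono) simp
    also have "\<dots> = emeasure ?M ?N"
      by (simp add: mult.assoc[symmetric] flip: ennreal_mult)
    finally show "ennreal (1 / 4 ^ n) * emeasure ?M (A \<inter> usphere) \<le> emeasure ?M ?N" .
  qed
qed

section \<open>Polar sets, caps and iterated integrals\<close>

text \<open>A point \<open>z\<close> of the segment is a combination of \<open>x\<close> and \<open>y\<close> with the nonnegative coefficients
\<open>sin (\<theta> - t) / sin \<theta>\<close> and \<open>sin t / sin \<theta>\<close>, where \<open>\<theta> = sdist x y < pi\<close>.\<close>
lemma inner_geodesic_le_0: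
  fixes x y z w :: "'a::euclidean_space"
  assumes x: "norm x = 1" and y: "norm y = 1" and ne: "x \<noteq> - y"
    and z: "z \<in> geodesic_segment x y" and wx: "w \<bullet> x \<le> 0" and wy: "w \<bullet> y \<le> 0"
  shows "norm z = 1" "w \<bullet> z \<le> 0"
proof -
  define \<theta> where "\<theta> = sdist x y"
  obtain t v where zt: "z = cos t *\<^sub>R x + sin t *\<^sub>R v" and v: "norm v = 1" "x \<bullet> v = 0"
    and t: "0 \<le> t" "t \<le> \<theta>" and yv: "cos \<theta> *\<^sub>R x + sin \<theta> *\<^sub>R v = y"
    using z unfolding geodesic_segment_def \<theta>_def by blast
  have "z \<bullet> z = (cos t)\<^sup>2 * (x \<bullet> x) + (sin t)\<^sup>2 * (v \<bullet> v)"
    using v by (simp add: zt inner_add_left inner_add_right inner_commute power2_eq_square)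
  then have "(norm z)\<^sup>2 = 1" using x v by (simp flip: power2_norm_eq_inner)
  then show "norm z = 1" by (simp add: power2_eq_1_iff) (use norm_ge_zero[of z] in linarith)
  have xy: "\<bar>x \<bullet> y\<bar> \<le> 1" using Cauchy_Schwarz_ineq2[of x y] x y by simp
  have "x \<bullet> y \<noteq> -1"
  proof
    assume "x \<bullet> y = -1"
    then have "(norm (x + y))\<^sup>2 = 0"
      using x y by (simp add: power2_norm_eq_inner inner_add_left inner_add_right inner_commute norm_eq_1)
    then show False using ne by (simp add: eq_neg_iff_add_eq_0)
  qed
  then have lt: "\<theta> < pi" "0 \<le> \<theta>"
    using xy arccos_eq_pi_iff[of "x \<bullet> y"] arccos_ubound[of "x \<bullet> y"] arccos_lbound[of "x \<bullet> y"]
    unfolding \<theta>_def sdist_def abs_le_iff by (auto simp: less_le)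
  show "w \<bullet> z \<le> 0"
  proof (cases "\<theta> = 0")
    case True
    then show ?thesis using t wx by (simp add: zt)
  next
    case False
    then have s: "0 < sin \<theta>" using lt by (intro sin_gt_zero) auto
    have "sin \<theta> * (w \<bullet> z) = sin (\<theta> - t) * (w \<bullet> x) + sin t * (w \<bullet> y)"
      by (simp add: zt inner_add_right sin_diff algebra_simps flip: yv)
    also have "\<dots> \<le> 0"
      using wx wy t lt by (intro add_nonpos_nonpos mult_nonneg_nonpos sin_ge_zero) auto
    finally show ?thesis using s by (simp add: mult_le_0_iff)
  qed
qed

text \<open>The closed hemisphere \<open>{y. x \<bullet> y \<le> 0}\<close> is convex, so it contains the hull of \<open>K\<close> as soon as it contains \<open>K\<close>.\<close>
lemma polar_set_sconv:
  assumes "K \<subseteq> usphere"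
  shows "polar_set (sconv K) = polar_set K"
proof (intro equalityI subsetI)
  fix x assume "x \<in> polar_set (sconv K)"
  then show "x \<in> polar_set K" by (auto simp: polar_set_def sconv_def)
next
  fix x assume x: "x \<in> polar_set K"
  have "sconvex {y \<in> usphere. x \<bullet> y \<le> 0}"
    unfolding sconvex_def
  proof (intro conjI ballI impI subsetI)
    fix y y' z
    assume "y \<in> {y \<in> usphere. x \<bullet> y \<le> 0}" "y' \<in> {y \<in> usphere. x \<bullet> y \<le> 0}"
      "y \<noteq> - y'" "z \<in> geodesic_segment y y'"
    then show "z \<in> {y \<in> usphere. x \<bullet> y \<le> 0}"
      using inner_geodesic_le_0[of y y' z x] by simp
  qed auto
  then have "sconv K \<subseteq> {y \<in> usphere. x \<bullet> y \<le> 0}"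
    using assms x unfolding sconv_def polar_set_def by fastforce
  then show "x \<in> polar_set (sconv K)"
    using x by (auto simp: polar_set_def)
qed

lemma sdist_less_iff:
  assumes "norm c = 1" "norm x = 1" "norm y = 1"
  shows "sdist c x < sdist c y \<longleftrightarrow> c \<bullet> y < c \<bullet> x"
  using Cauchy_Schwarz_ineq2[of c x] Cauchy_Schwarz_ineq2[of c y] assms
  unfolding sdist_def by (intro arccos_less_mono) auto

lemma continuous_on_sdist: "norm c = 1 \<Longrightarrow> continuous_on usphere (sdist c)"
  unfolding sdist_def
proof (rule continuous_on_arccos)
  assume c: "norm c = 1"
  have "\<bar>c \<bullet> x\<bar> \<le> 1" if "x \<in> usphere" for x
    using Cauchy_Schwarz_ineq2[of c x] c that by simp
  then show "\<forall>x\<in>usphere. - 1 \<le> c \<bullet> x \<and> c \<bullet> x \<le> 1" by (simp only: abs_le_iff) force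
qed (intro continuous_intros)

lemma (in reflection_invariant) is_cap_cap_about:
  assumes "is_cap c C"
  shows "cap_about c C" "C \<subseteq> usphere"
proof -
  obtain r where c: "norm c = 1" and r: "C = {x \<in> usphere. sdist c x \<le> r} \<or> C = {x \<in> usphere. sdist c x < r}"
    using assms by (auto simp: is_cap_def)
  then show "C \<subseteq> usphere" by blast
  have le: "closed {x \<in> usphere. sdist c x \<le> r}"
    using continuous_closed_preimage[OF continuous_on_sdist[OF c], of "{..r}"] by (simp add: vimage_def Int_def)
  have ge: "closed {x \<in> usphere. r \<le> sdist c x}"
    using continuous_closed_preimage[OF continuous_on_sdist[OF c], of "{r..}"] by (simp add: vimage_def Int_def)
  have "{x \<in> usphere. sdist c x < r} = usphere - {x \<in> usphere. r \<le> sdist c x}" by auto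
  then have "{x \<in> usphere. sdist c x < r} \<in> sets borel" using ge by auto
  then have "C \<in> sets borel" using r le by auto
  moreover have "c \<bullet> y < c \<bullet> x" if "x \<in> C" "y \<in> usphere - C" for x y
    using that r c by (subst sdist_less_iff[symmetric]) auto
  ultimately show "cap_about c C" by (auto simp: cap_about_def)
qed

context reflection_invariant begin

text \<open>The measure of the polar set is the integral over \<open>y\<close> of the product of the indicators of
\<open>x i \<bullet> y \<le> 0\<close>; after exchanging the integrals, the integral over the \<open>x i\<close> factorizes.\<close>
lemma nn_integral_polar:
  assumes I: "finite I" and g: "\<And>i. i \<in> I \<Longrightarrow> g i \<in> borel_measurable M"
  shows "(\<integral>\<^sup>+ x. emeasure M (polar_set (sconv (x ` I))) * (\<Prod>i\<in>I. ennreal (g i (x i))) \<partial>(\<Pi>\<^sub>M i\<in>I. M))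
    = (\<integral>\<^sup>+ y. (\<Prod>i\<in>I. \<integral>\<^sup>+ x. ennreal (g i x) * indicator {x. x \<bullet> y \<le> 0} x \<partial>M) \<partial>M)"
proof -
  interpret S: product_sigma_finite "\<lambda>_. M" ..
  interpret F: finite_product_sigma_finite "\<lambda>_. M" I by unfold_locales (rule I)
  interpret P: pair_sigma_finite "\<Pi>\<^sub>M i\<in>I. M" M ..
  let ?k = "\<lambda>y. indicator {x. x \<bullet> y \<le> 0} :: 'a \<Rightarrow> ennreal"
  have gm: "(\<lambda>x. ennreal (g i x)) \<in> borel_measurable M" if "i \<in> I" for i
    using g[OF that] by measurable
  have meas: "(\<lambda>(x, y). \<Prod>i\<in>I. ennreal (g i (x i)) * ?k y (x i)) \<in> borel_measurable ((\<Pi>\<^sub>M i\<in>I. M) \<Otimes>\<^sub>M M)"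
  proof (unfold case_prod_beta, intro borel_measurable_prod_ennreal borel_measurable_times_ennreal)
    fix i assume i: "i \<in> I"
    have c [measurable]: "(\<lambda>w. fst w i) \<in> (\<Pi>\<^sub>M i\<in>I. M) \<Otimes>\<^sub>M M \<rightarrow>\<^sub>M M"
      using i by measurable
    have c': "(\<lambda>w. fst w i) \<in> borel_measurable ((\<Pi>\<^sub>M i\<in>I. M) \<Otimes>\<^sub>M M)"
      using measurable_compose[OF c id_measurable] .
    have d': "(\<lambda>w. snd w) \<in> borel_measurable ((\<Pi>\<^sub>M i\<in>I. M) \<Otimes>\<^sub>M M)"
      using measurable_compose[OF measurable_snd id_measurable] .
    show "(\<lambda>w. ennreal (g i (fst w i))) \<in> borel_measurable ((\<Pi>\<^sub>M i\<in>I. M) \<Otimes>\<^sub>M M)"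
      using measurable_compose[OF c gm[OF i]] .
    show "(\<lambda>w. ?k (snd w) (fst w i)) \<in> borel_measurable ((\<Pi>\<^sub>M i\<in>I. M) \<Otimes>\<^sub>M M)"
      unfolding indicator_def using c' d' by measurable
  qed
  have inner: "emeasure M (polar_set (sconv (x ` I))) * (\<Prod>i\<in>I. ennreal (g i (x i)))
      = (\<integral>\<^sup>+ y. (\<Prod>i\<in>I. ennreal (g i (x i)) * ?k y (x i)) \<partial>M)"
    if x: "x \<in> space (\<Pi>\<^sub>M i\<in>I. M)" for x
  proof -
    have xi: "x i \<in> usphere" if "i \<in> I" for i using x that by (auto simp: space_PiM space_M PiE_iff simp del: mem_sphere_0)
    let ?Q = "polar_set (x ` I)"
    have Q: "polar_set (sconv (x ` I)) = ?Q" using xi by (intro polar_set_sconv) auto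
    have "?Q = {y \<in> space M. \<forall>i\<in>I. y \<bullet> x i \<le> 0}" by (auto simp: polar_set_def space_M)
    also have "\<dots> \<in> sets M"
      using I by measurable
    finally have Qm: "?Q \<in> sets M" .
    have "(\<integral>\<^sup>+ y. (\<Prod>i\<in>I. ennreal (g i (x i)) * ?k y (x i)) \<partial>M)
        = (\<integral>\<^sup>+ y. (\<Prod>i\<in>I. ennreal (g i (x i))) * indicator ?Q y \<partial>M)"
    proof (rule nn_integral_cong)
      fix y assume "y \<in> space M"
      then have "(\<Prod>i\<in>I. ?k y (x i)) = indicator ?Q y"
        using I by (auto simp: polar_set_def space_M indicator_def inner_commute prod.If_cases)
      then show "(\<Prod>i\<in>I. ennreal (g i (x i)) * ?k y (x i)) = (\<Prod>i\<in>I. ennreal (g i (x i))) * indicator ?Q y"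
        by (simp add: prod.distrib)
    qed
    also have "\<dots> = (\<Prod>i\<in>I. ennreal (g i (x i))) * emeasure M ?Q"
      using Qm by (rule nn_integral_cmult_indicator)
    finally show ?thesis by (simp add: Q mult.commute)
  qed
  have "(\<integral>\<^sup>+ x. emeasure M (polar_set (sconv (x ` I))) * (\<Prod>i\<in>I. ennreal (g i (x i))) \<partial>(\<Pi>\<^sub>M i\<in>I. M))
    = (\<integral>\<^sup>+ x. (\<integral>\<^sup>+ y. (\<Prod>i\<in>I. ennreal (g i (x i)) * ?k y (x i)) \<partial>M) \<partial>(\<Pi>\<^sub>M i\<in>I. M))"
    by (rule nn_integral_cong) (rule inner)
  also have "\<dots> = (\<integral>\<^sup>+ y. (\<integral>\<^sup>+ x. (\<Prod>i\<in>I. ennreal (g i (x i)) * ?k y (x i)) \<partial>(\<Pi>\<^sub>M i\<in>I. M)) \<partial>M)"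
    using P.Fubini'[OF meas] by simp
  also have "\<dots> = (\<integral>\<^sup>+ y. (\<Prod>i\<in>I. \<integral>\<^sup>+ x. ennreal (g i x) * ?k y x \<partial>M) \<partial>M)"
    using gm I by (intro nn_integral_cong S.product_nn_integral_prod) auto
  finally show ?thesis .
qed

text \<open>Passes from the functions \<open>g i\<close>, which are only known to be measurable for the surface measure, to
Borel functions with values in \<open>[0, 1]\<close>: once the integral is factorized, each \<open>g i\<close> matters only up to a null set.\<close>
lemma nn_integral_polar_eq_polar_functional:
  assumes I: "finite I" and g: "\<And>i. i \<in> I \<Longrightarrow> g i \<in> borel_measurable M"
    and h: "\<And>i. i \<in> I \<Longrightarrow> unit_valued (h i)" and L: "\<And>i. i \<in> I \<Longrightarrow> 0 \<le> L i"
    and AE: "\<And>i. i \<in> I \<Longrightarrow> AE x in M. g i x = L i * h i x"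
  shows "(\<integral>\<^sup>+ x. emeasure M (polar_set (sconv (x ` I))) * (\<Prod>i\<in>I. ennreal (g i (x i))) \<partial>(\<Pi>\<^sub>M i\<in>I. M))
    = ennreal ((\<Prod>i\<in>I. L i) * polar_functional I h)"
proof -
  have inner: "(\<integral>\<^sup>+ x. ennreal (g i x) * indicator {x. x \<bullet> y \<le> 0} x \<partial>M) = ennreal (L i * hemi (h i) y)"
    if i: "i \<in> I" for i y
  proof -
    have "(\<integral>\<^sup>+ x. ennreal (g i x) * indicator {x. x \<bullet> y \<le> 0} x \<partial>M)
        = (\<integral>\<^sup>+ x. ennreal (L i * (h i x * indicator {x. x \<bullet> y \<le> 0} x)) \<partial>M)"
      using AE[OF i] by (intro nn_integral_cong_AE) (auto simp: indicator_def)
    also have "\<dots> = ennreal (\<integral>x. L i * (h i x * indicator {x. x \<bullet> y \<le> 0} x) \<partial>M)"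
      using integrable_hemi[OF h[OF i], of y] L[OF i] unit_valuedD(2)[OF h[OF i]]
      by (intro nn_integral_eq_integral) auto
    finally show ?thesis by (simp add: hemi_def)
  qed
  have "(\<integral>\<^sup>+ y. (\<Prod>i\<in>I. \<integral>\<^sup>+ x. ennreal (g i x) * indicator {x. x \<bullet> y \<le> 0} x \<partial>M) \<partial>M)
      = (\<integral>\<^sup>+ y. ennreal ((\<Prod>i\<in>I. L i) * (\<Prod>i\<in>I. hemi (h i) y)) \<partial>M)"
    using L hemi_nonneg[OF h] by (simp add: inner prod_ennreal prod.distrib)
  also have "\<dots> = ennreal (\<integral>y. (\<Prod>i\<in>I. L i) * (\<Prod>i\<in>I. hemi (h i) y) \<partial>M)"
    using prod_hemi(3)[of I h] L h hemi_nonneg[OF h]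
    by (intro nn_integral_eq_integral) (auto intro!: mult_nonneg_nonneg prod_nonneg)
  finally show ?thesis
    using nn_integral_polar[OF I g] by (simp add: polar_functional_def)
qed

end

section \<open>The rearrangement inequality\<close>

text \<open>The positivity excludes an infinite essential supremum, which \<open>real_of_ereal\<close> would map to \<open>0\<close>.\<close>
lemma Linf_norm_bound:
  fixes f :: "'a \<Rightarrow> real"
  assumes "0 < Linf_norm M f"
  shows "AE x in M. \<bar>f x\<bar> \<le> Linf_norm M f"
proof -
  have "esssup M (\<lambda>x. ereal \<bar>f x\<bar>) = ereal (Linf_norm M f)"
    using assms unfolding Linf_norm_def by (cases "esssup M (\<lambda>x. ereal \<bar>f x\<bar>)") auto
  then show ?thesis
    using esssup_AE[of "\<lambda>x. ereal \<bar>f x\<bar>" M] by simp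
qed

theorem theorem1p3:
  fixes n N :: nat
    and f :: "nat \<Rightarrow> real ^ 'm \<Rightarrow> real"
    and C :: "nat \<Rightarrow> (real ^ 'm) set"
    and c :: "real ^ 'm"
  assumes dim: "CARD('m) = n + 1" and n: "n \<ge> 1"
    and nonneg: "\<And>i x. i \<in> {1..N} \<Longrightarrow> x \<in> usphere \<Longrightarrow> f i x \<ge> 0"
    and bounded: "\<And>i. i \<in> {1..N} \<Longrightarrow> bounded (f i ` usphere)"
    and integrable: "\<And>i. i \<in> {1..N} \<Longrightarrow> integrable (sphere_measure n) (f i)"
    and proper: "\<And>i. i \<in> {1..N} \<Longrightarrow> has_proper_support (f i)"
    and pos: "\<And>i. i \<in> {1..N} \<Longrightarrow> Linf_norm (sphere_measure n) (f i) > 0"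
    and caps: "\<And>i. i \<in> {1..N} \<Longrightarrow> is_cap c (C i)"
    and cap_measure: "\<And>i. i \<in> {1..N} \<Longrightarrow>
      measure (sphere_measure n) (C i)
        = L1_norm (sphere_measure n) (f i) / Linf_norm (sphere_measure n) (f i)"
  shows "I_tilde n N f
    \<le> I_tilde n N (\<lambda>i x. Linf_norm (sphere_measure n) (f i) * indicator (C i) x)"
proof -
  let ?M = "sphere_measure n :: (real^'m) measure" and ?I = "{1..N}"
  interpret reflection_invariant ?M "1 / 4 ^ n"
    using dim n by (rule reflection_invariant_sphere_measure)
  define L where "L i = Linf_norm ?M (f i)" for i
  have L: "0 < L i" if "i \<in> ?I" for i using pos[OF that] by (simp add: L_def)
  have "\<exists>h. unit_valued h \<and> (AE x in ?M. f i x = L i * h x)" if i: "i \<in> ?I" for i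
  proof -
    obtain g where g [measurable]: "g \<in> borel_measurable borel" and eq: "AE x in ?M. f i x = g x"
      using sphere_measure_borel_version[OF borel_measurable_integrable[OF integrable[OF i]]
        hausdorff_outer_usphere_finite[OF dim]] by blast
    \<comment> \<open>Clipping changes \<open>g / L\<close> only on a null set and gives bounds that hold everywhere.\<close>
    define h where "h x = max 0 (min 1 (g x / L i))" for x
    have "h \<in> borel_measurable borel" unfolding h_def by measurable
    then have "unit_valued h" by (simp add: unit_valued_def h_def)
    moreover have "AE x in ?M. f i x = L i * h x"
      using eq Linf_norm_bound[OF pos[OF i]] AE_space
    proof eventually_elim
      case (elim x)
      have "0 \<le> f i x" using elim nonneg[OF i, of x] by simp
      then show ?case using elim L[OF i] by (simp add: h_def L_def[symmetric])
    qed
    ultimately show ?thesis by blast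
  qed
  then obtain h where h: "\<And>i. i \<in> ?I \<Longrightarrow> unit_valued (h i)" "\<And>i. i \<in> ?I \<Longrightarrow> AE x in ?M. f i x = L i * h i x"
    by metis
  have cap: "cap_about c (C i)" "C i \<subseteq> usphere" "C i \<in> sets borel" if "i \<in> ?I" for i
    using is_cap_cap_about[OF caps[OF that]] by (auto simp: cap_about_def)
  have mass: "(\<integral>x. h i x \<partial>?M) = measure ?M (C i \<inter> usphere)" if i: "i \<in> ?I" for i
  proof -
    have "L1_norm ?M (f i) = (\<integral>x. L i * h i x \<partial>?M)"
      unfolding L1_norm_def
    proof (rule integral_cong_AE)
      show "AE x in ?M. \<bar>f i x\<bar> = L i * h i x"
        using h(2)[OF i]
      proof eventually_elim
        case (elim x)
        have "0 \<le> L i * h i x"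
          using L[OF i] unit_valuedD(2)[OF h(1)[OF i], of x] by simp
        then show ?case using elim by simp
      qed
    qed (use integrable[OF i] unit_valuedD(1)[OF h(1)[OF i]] in measurable)
    moreover have "C i \<inter> usphere = C i" using cap(2)[OF i] by blast
    ultimately show ?thesis
      using cap_measure[OF i] L[OF i] by (simp add: L_def)
  qed
  have "polar_functional ?I h \<le> polar_functional ?I (\<lambda>i. indicator (C i))"
    using cap h mass by (intro polar_functional_le_caps) auto
  then have "(\<Prod>i\<in>?I. L i) * polar_functional ?I h \<le> (\<Prod>i\<in>?I. L i) * polar_functional ?I (\<lambda>i. indicator (C i))"
    using L by (intro mult_left_mono prod_nonneg) (auto intro: less_imp_le)
  moreover have "I_tilde n N f = ennreal ((\<Prod>i\<in>?I. L i) * polar_functional ?I h)"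
    unfolding I_tilde_def using h L integrable
    by (intro nn_integral_polar_eq_polar_functional) (auto intro: less_imp_le)
  moreover have "I_tilde n N (\<lambda>i x. L i * indicator (C i) x) = ennreal ((\<Prod>i\<in>?I. L i) * polar_functional ?I (\<lambda>i. indicator (C i)))"
    unfolding I_tilde_def using L cap(3)
    by (intro nn_integral_polar_eq_polar_functional) (auto intro: less_imp_le unit_valued_indicator)
  ultimately show ?thesis
    unfolding L_def by (simp add: ennreal_leI)
qed

end
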